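(* Let a Haar-type expansion with $K+1$ basis functions be given (see context), and let $\gamma>0$. Consider the two-dimensional isentropic Euler equations $\partial_tu+\partial_{x_1}f_1(u)+\partial_{x_2}f_2(u)=0$ for $u=(\rho,q_1,q_2)^T$ with $$f_1(u)=\begin{pmatrix}q_1\\ \frac{q_1^2}{\rho}+p(\rho)\\ \frac{q_1q_2}{\rho}\end{pmatrix},\qquad f_2(u)=\begin{pmatrix}q_2\\ \frac{q_1q_2}{\rho}\\ \frac{q_2^2}{\rho}+p(\rho)\end{pmatrix},\qquad p(\rho)=\rho^\gamma .$$ For $\hat u=(\hat\rho,\hat q_1,\hat q_2)$ with $\hat\rho\in\mathbb{H}^+$ and $\hat q_1,\hat q_2\in\mathbb{R}^{K+1}$ define, for $i=1,2$, $$\mathcal{D}_{\nu_i}(\hat u):=\mathcal{D}(\hat q_i)\mathcal{D}(\hat\rho)^{-1},\qquad \nu_i(\hat u):=\mathcal{H}\,\mathcal{D}_{\nu_i}(\hat u)\,\mathcal{H}^T\hat e_1,$$ and, for $\vec n=(n_1,n_2)^T$, $\vec n\cdot\mathcal{D}_\nu(\hat u):=n_1\mathcal{D}_{\nu_1}(\hat u)+n_2\mathcal{D}_{\nu_2}(\hat u)$. Then the projected pressure law (the gPC modes of $p(\Pi_K[\hat\rho])$) is $\hat p(\hat\rho)=\mathcal{H}\,\mathcal{D}(\hat\rho)^\gamma\,\mathcal{H}^T\hat e_1$, and a Haar-type stochastic Galerkin formulation, defined for all states $\hat u$ with $\hat\rho\in\mathbb{H}^+$, is $$\partial_t\hat u+\partial_{x_1}\hat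 f_1(\hat u)+\partial_{x_2}\hat f_2(\hat u)=0,$$ $$\hat f_1(\hat u)=\begin{pmatrix}\nu_1(\hat u)\ast\hat\rho\\ \nu_1(\hat u)^{\ast2}\ast\hat\rho+\hat p(\hat\rho)\\ \nu_1(\hat u)\ast\nu_2(\hat u)\ast\hat\rho\end{pmatrix},\qquad \hat f_2(\hat u)=\begin{pmatrix}\nu_2(\hat u)\ast\hat\rho\\ \nu_1(\hat u)\ast\nu_2(\hat u)\ast\hat\rho\\ \nu_2(\hat u)^{\ast2}\ast\hat\rho+\hat p(\hat\rho)\end{pmatrix};$$ that is, the block components of $\hat f_i(\hat u)$ are the gPC modes of the components of $f_i\big((\Pi_K[\hat\rho],\Pi_K[\hat q_1],\Pi_K[\hat q_2])^T\big)$. For every unit vector $\vec n=(n_1,n_2)^T\in\mathbb{R}^2$, the matrix $\vec n\cdot\mathrm{D}_{\hat u}\hat f(\hat u):=n_1\mathrm{D}_{\hat u}\hat f_1(\hat u)+n_2\mathrm{D}_{\hat u}\hat f_2(\hat u)$ has the real spectrum $$\sigma\big\{\vec n\cdot\mathrm{D}_{\hat u}\hat f(\hat u)\big\}=\Big\{\vec n\cdot\mathcal{D}_\nu(\hat u)\pm\sqrt\gamma\,\mathcal{D}(\hat\rho)^{\frac{\gamma-1}2},\ \vec n\cdot\mathcal{D}_\nu(\hat u)\Big\}.$$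
   Context: Haar-type expansion. Let $K\in\mathbb{N}_0$ and let $\xi\sim\mathcal{U}(0,1)$ be uniformly distributed, with law $\mathbb{P}$; write $\langle f,g\rangle_{\mathbb{P}}=\mathbb{E}[f(\xi)g(\xi)]$. Matrix and vector indices run over $0,\dots,K$. The canonical Haar matrix $A_c\in\mathbb{R}^{(K+1)\times(K+1)}$ has all entries equal to $1$ in row $0$; for $i=1,\dots,K$, row $i$ has zeros in columns $0,\dots,i-2$, the entry $h^d_i=s_ih^r_i$ in column $i-1$, and the entry $h^r_i=\sqrt{(K+1)/(s_i^2-s_i)}$ in columns $i,\dots,K$, where $s_i=-(K+1-i)$. A Haar-type matrix is $A=\begin{pmatrix}1&0\\0&O\end{pmatrix}A_c$ with an arbitrary orthogonal $O\in\mathbb{R}^{K\times K}$; it satisfies $AA^T=(K+1)I$. Its basis functions are $\phi_k(\xi)=\sum_{\ell=0}^K A_{k\ell}\,\chi_{[0,1]}((K+1)\xi-\ell)$, $k=0,\dots,K$ (so $\phi_0=1$ a.s. on $[0,1]$); they are orthonormal in $L^2(\mathbb{P})$. Put $\mathcal{H}:=A/\sqrt{K+1}$, an orthogonal matrix. For $\hat w\in\mathbb{R}^{K+1}$ let $\Pi_K[\hat w](\xi)=\sum_{k=0}^K\hat w_k\phi_k(\xi)$. The gPC modes of a square-integrable random variable $g(\xi)$ are the coefficients $\langle g,\phi_k\rangle_{\mathbb{P}}$, $k=0,\dots,K$. The stochastic Galerkin matrix is $\mathcal{P}(\hat w)=\sum_{k=0}^K\hat w_k\mathcal{M}_k$ with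 $\mathcal{M}_k=(\langle\phi_k,\phi_i\phi_j\rangle_{\mathbb{P}})_{i,j=0,\dots,K}$, the Galerkin product is $\hat w\ast\hat q=\mathcal{P}(\hat w)\hat q$ (iterated products $\hat a\ast\hat b\ast\hat c$ mean $\mathcal{P}(\hat a)\mathcal{P}(\hat b)\hat c$), and $\hat w^{\ast m}=\mathcal{P}(\hat w)^m\hat e_1$, where $\hat e_1=(1,0,\dots,0)^T\in\mathbb{R}^{K+1}$. For Haar-type expansions $\mathcal{P}(\hat w)=\mathcal{H}\mathcal{D}(\hat w)\mathcal{H}^T$ with $\mathcal{D}(\hat w)$ a diagonal matrix of eigenvalues. $\mathbb{H}^+$ is the set of $\hat w\in\mathbb{R}^{K+1}$ for which $\mathcal{P}(\hat w)$ is strictly positive definite. Powers of diagonal matrices are taken entrywise on the diagonal. A spectrum written as a set of diagonal matrices means: the eigenvalues are the diagonal entries of these $(K+1)\times(K+1)$ matrices. *)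

theory Defs
  imports "HOL-Analysis.Analysis"
begin

section \<open>Index sets\<close>

text \<open>
  The index set \<open>{0,\<dots>,K}\<close> is a finite linearly ordered type \<open>'n\<close> with \<open>CARD('n) = K + 1\<close>;
  \<open>idx\<close> is its order isomorphism onto \<open>{0,\<dots>,K}\<close>. Every \<open>K \<ge> 0\<close> occurs, e.g. for the
  numeral types.
\<close>

type_synonym 'n rvec = "(real, 'n) vec"
type_synonym 'n sqmat = "((real, 'n) vec, 'n) vec"
type_synonym 'n state = "(real, 3 \<times> 'n) vec"

definition idx :: "'n::{finite,linorder} \<Rightarrow> nat" where
  "idx i = card {..<i}"

definition e1 :: "'n::{finite,linorder} rvec" where
  "e1 = (\<chi> k. if idx k = 0 then 1 else 0)"


section \<open>Haar-type matrices\<close>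

definition haar_s :: "nat \<Rightarrow> nat \<Rightarrow> real" where
  "haar_s K i = - (real K + 1 - real i)"

definition haar_r :: "nat \<Rightarrow> nat \<Rightarrow> real" where
  "haar_r K i = sqrt ((real K + 1) / ((haar_s K i)\<^sup>2 - haar_s K i))"

definition haar_entry :: "nat \<Rightarrow> nat \<Rightarrow> nat \<Rightarrow> real" where
  "haar_entry K i l =
     (if i = 0 then 1
      else if l < i - 1 then 0
      else if l = i - 1 then haar_s K i * haar_r K i
      else haar_r K i)"

definition haar_canonical :: "'n::{finite,linorder} sqmat" where
  "haar_canonical = (\<chi> i l. haar_entry (CARD('n) - 1) (idx i) (idx l))"

text \<open>A \<open>K \<times> K\<close> matrix, where \<open>K = 0\<close> is allowed, is a function restricted to the indices
  \<open>1,\<dots>,K\<close>, that is to its rows and columns in the block matrix below.\<close>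

definition orthogonal_upto :: "nat \<Rightarrow> (nat \<Rightarrow> nat \<Rightarrow> real) \<Rightarrow> bool" where
  "orthogonal_upto K R \<longleftrightarrow>
     (\<forall>i\<in>{1..K}. \<forall>j\<in>{1..K}.
        (\<Sum>l=1..K. R i l * R j l) = (if i = j then 1 else 0) \<and>
        (\<Sum>l=1..K. R l i * R l j) = (if i = j then 1 else 0))"

definition one_block :: "(nat \<Rightarrow> nat \<Rightarrow> real) \<Rightarrow> 'n::{finite,linorder} sqmat" where
  "one_block R =
     (\<chi> i j. if idx i = 0 \<and> idx j = 0 then 1
            else if idx i = 0 \<or> idx j = 0 then 0
            else R (idx i) (idx j))"

definition haar_type :: "'n::{finite,linorder} sqmat \<Rightarrow> bool" where
  "haar_type A \<longleftrightarrow>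
     (\<exists>R. orthogonal_upto (CARD('n) - 1) R \<and> A = one_block R ** haar_canonical)"

definition haar_H :: "'n::{finite,linorder} sqmat \<Rightarrow> 'n sqmat" where
  "haar_H A = (1 / sqrt (real CARD('n))) *\<^sub>R A"


section \<open>Basis functions and polynomial chaos modes\<close>

definition law :: "real measure" where
  "law = uniform_measure lborel {0..1}"

definition cell :: "'n::{finite,linorder} \<Rightarrow> real \<Rightarrow> real" where
  "cell l \<xi> = indicator {0..1} (real CARD('n) * \<xi> - real (idx l))"

definition basis_fun :: "'n::{finite,linorder} sqmat \<Rightarrow> 'n \<Rightarrow> real \<Rightarrow> real" where
  "basis_fun A k \<xi> = (\<Sum>l\<in>UNIV. A $ k $ l * cell l \<xi>)"

definition ip :: "(real \<Rightarrow> real) \<Rightarrow> (real \<Rightarrow> real) \<Rightarrow> real" where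
  "ip f g = (LINT \<xi>|law. f \<xi> * g \<xi>)"

definition square_integrable :: "(real \<Rightarrow> real) \<Rightarrow> bool" where
  "square_integrable g \<longleftrightarrow> g \<in> borel_measurable law \<and> integrable law (\<lambda>\<xi>. (g \<xi>)\<^sup>2)"

definition expansion :: "'n::{finite,linorder} sqmat \<Rightarrow> 'n rvec \<Rightarrow> real \<Rightarrow> real" where
  "expansion A w \<xi> = (\<Sum>k\<in>UNIV. w $ k * basis_fun A k \<xi>)"

definition modes :: "'n::{finite,linorder} sqmat \<Rightarrow> (real \<Rightarrow> real) \<Rightarrow> 'n rvec" where
  "modes A g = (\<chi> k. ip g (basis_fun A k))"


section \<open>Galerkin matrix, product and powers\<close>

definition triple_mat :: "'n::{finite,linorder} sqmat \<Rightarrow> 'n \<Rightarrow> 'n sqmat" where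
  "triple_mat A k =
     (\<chi> i j. ip (basis_fun A k) (\<lambda>\<xi>. basis_fun A i \<xi> * basis_fun A j \<xi>))"

definition galerkin_mat :: "'n::{finite,linorder} sqmat \<Rightarrow> 'n rvec \<Rightarrow> 'n sqmat" where
  "galerkin_mat A w = (\<Sum>k\<in>UNIV. w $ k *\<^sub>R triple_mat A k)"

definition gprod :: "'n::{finite,linorder} sqmat \<Rightarrow> 'n rvec \<Rightarrow> 'n rvec \<Rightarrow> 'n rvec" where
  "gprod A w q = galerkin_mat A w *v q"

definition gpow :: "'n::{finite,linorder} sqmat \<Rightarrow> 'n rvec \<Rightarrow> nat \<Rightarrow> 'n rvec" where
  "gpow A w m = ((\<lambda>v. galerkin_mat A w *v v) ^^ m) e1"

text \<open>Since \<open>haar_H A\<close> is orthogonal for a Haar-type \<open>A\<close>, this is the unique solution \<open>D\<close> of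
  \<open>galerkin_mat A w = haar_H A ** D ** transpose (haar_H A)\<close>. It is diagonal: see
  \<open>eig_mat_diagonal\<close> and \<open>galerkin_mat_eq\<close> below.\<close>

definition eig_mat :: "'n::{finite,linorder} sqmat \<Rightarrow> 'n rvec \<Rightarrow> 'n sqmat" where
  "eig_mat A w = transpose (haar_H A) ** galerkin_mat A w ** haar_H A"

definition pos_def :: "'n::finite sqmat \<Rightarrow> bool" where
  "pos_def M \<longleftrightarrow> transpose M = M \<and> (\<forall>v. v \<noteq> 0 \<longrightarrow> 0 < v \<bullet> (M *v v))"

definition pos_states :: "'n::{finite,linorder} sqmat \<Rightarrow> 'n rvec set" where
  "pos_states A = {w. pos_def (galerkin_mat A w)}"

text \<open>Entrywise power of a diagonal matrix.\<close>

definition diag_powr :: "'n sqmat \<Rightarrow> real \<Rightarrow> 'n::finite sqmat" where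
  "diag_powr M a = (\<chi> i j. if i = j then (M $ i $ i) powr a else 0)"


section \<open>Isentropic Euler equations and their Galerkin formulation\<close>

definition euler_flux1 :: "real \<Rightarrow> real^3 \<Rightarrow> real^3" where
  "euler_flux1 \<gamma> u =
     vector [u$2, (u$2)\<^sup>2 / u$1 + u$1 powr \<gamma>, u$2 * u$3 / u$1]"

definition euler_flux2 :: "real \<Rightarrow> real^3 \<Rightarrow> real^3" where
  "euler_flux2 \<gamma> u =
     vector [u$3, u$2 * u$3 / u$1, (u$3)\<^sup>2 / u$1 + u$1 powr \<gamma>]"

text \<open>A state, a vector of length \<open>3 (K + 1)\<close>, is indexed by pairs (block, mode). Block \<open>1\<close> is the
  density, blocks \<open>2\<close> and \<open>3\<close> are the two momenta.\<close>

definition block :: "3 \<Rightarrow> 'n state \<Rightarrow> 'n::finite rvec" where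
  "block c u = (\<chi> k. u $ (c, k))"

definition stack :: "('n rvec)^3 \<Rightarrow> 'n::finite state" where
  "stack B = (\<chi> p. B $ fst p $ snd p)"

definition random_state ::
  "'n::{finite,linorder} sqmat \<Rightarrow> 'n state \<Rightarrow> real \<Rightarrow> real^3" where
  "random_state A u \<xi> = (\<chi> c. expansion A (block c u) \<xi>)"

definition D_nu :: "'n::{finite,linorder} sqmat \<Rightarrow> 3 \<Rightarrow> 'n state \<Rightarrow> 'n sqmat" where
  "D_nu A c u = eig_mat A (block c u) ** matrix_inv (eig_mat A (block 1 u))"

abbreviation "D_nu1 A \<equiv> D_nu A 2"
abbreviation "D_nu2 A \<equiv> D_nu A 3"

definition nu1 :: "'n::{finite,linorder} sqmat \<Rightarrow> 'n state \<Rightarrow> 'n rvec" where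
  "nu1 A u = haar_H A ** D_nu1 A u ** transpose (haar_H A) *v e1"

definition nu2 :: "'n::{finite,linorder} sqmat \<Rightarrow> 'n state \<Rightarrow> 'n rvec" where
  "nu2 A u = haar_H A ** D_nu2 A u ** transpose (haar_H A) *v e1"

definition p_hat :: "'n::{finite,linorder} sqmat \<Rightarrow> real \<Rightarrow> 'n rvec \<Rightarrow> 'n rvec" where
  "p_hat A \<gamma> \<rho> = haar_H A ** diag_powr (eig_mat A \<rho>) \<gamma> ** transpose (haar_H A) *v e1"

definition f_hat1 ::
  "'n::{finite,linorder} sqmat \<Rightarrow> real \<Rightarrow> 'n state \<Rightarrow> 'n state" where
  "f_hat1 A \<gamma> u = stack (vector
     [gprod A (nu1 A u) (block 1 u),
      gprod A (gpow A (nu1 A u) 2) (block 1 u) + p_hat A \<gamma> (block 1 u),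
      gprod A (nu1 A u) (gprod A (nu2 A u) (block 1 u))])"

definition f_hat2 ::
  "'n::{finite,linorder} sqmat \<Rightarrow> real \<Rightarrow> 'n state \<Rightarrow> 'n state" where
  "f_hat2 A \<gamma> u = stack (vector
     [gprod A (nu2 A u) (block 1 u),
      gprod A (nu1 A u) (gprod A (nu2 A u) (block 1 u)),
      gprod A (gpow A (nu2 A u) 2) (block 1 u) + p_hat A \<gamma> (block 1 u)])"

text \<open>The stochastic Galerkin projection of a flux \<open>f\<close>: the modes of \<open>f\<close> evaluated at the
  truncated expansion.\<close>

definition projected_flux ::
  "'n::{finite,linorder} sqmat \<Rightarrow> (real^3 \<Rightarrow> real^3) \<Rightarrow> 'n state \<Rightarrow> 'n state" where
  "projected_flux A f u = stack (\<chi> c. modes A (\<lambda>\<xi>. f (random_state A u \<xi>) $ c))"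

text \<open>Pointwise solutions of \<open>\<partial>\<^sub>t U + \<partial>\<^sub>x F1(U) + \<partial>\<^sub>y F2(U) = 0\<close> on \<open>\<Omega>\<close>, with points
  \<open>(t, x, y)\<close>.\<close>

definition conservation_law ::
  "('s \<Rightarrow> 's) \<Rightarrow> ('s \<Rightarrow> 's) \<Rightarrow> (real \<times> real \<times> real) set
     \<Rightarrow> (real \<times> real \<times> real \<Rightarrow> 's::real_normed_vector) \<Rightarrow> bool" where
  "conservation_law F1 F2 \<Omega> U \<longleftrightarrow>
     (\<forall>(t, x, y)\<in>\<Omega>. \<exists>a b c.
        ((\<lambda>s. U (s, x, y)) has_vector_derivative a) (at t) \<and>
        ((\<lambda>s. F1 (U (t, s, y))) has_vector_derivative b) (at x) \<and>
        ((\<lambda>s. F2 (U (t, x, s))) has_vector_derivative c) (at y) \<and>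
        a + b + c = 0)"


section \<open>Spectrum\<close>

definition eigenvalues :: "real^'m^'m \<Rightarrow> complex set" where
  "eigenvalues M =
     {\<mu>. \<exists>v::complex^'m. v \<noteq> 0 \<and> map_matrix complex_of_real M *v v = \<mu> *s v}"

definition char_fun :: "real^'m^'m \<Rightarrow> complex \<Rightarrow> complex" where
  "char_fun M z = det (mat z - map_matrix complex_of_real M)"

section \<open>Diagonalisation of the Galerkin matrix\<close>

lemma bij_betw_idx: "bij_betw (idx :: 'n::{finite,linorder} \<Rightarrow> nat) UNIV {..<CARD('n)}"
proof -
  have lt: "idx i < idx j" if "i < j" for i j :: 'n
    unfolding idx_def by (rule psubset_card_mono) (use that in auto)
  have inj: "inj (idx :: 'n \<Rightarrow> nat)"
    by (rule injI) (metis lt less_irrefl neqE)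
  have "range (idx :: 'n \<Rightarrow> nat) \<subseteq> {..<CARD('n)}"
    unfolding idx_def by (auto intro!: psubset_card_mono)
  moreover have "card (range (idx :: 'n \<Rightarrow> nat)) = CARD('n)"
    using inj by (simp add: card_image)
  ultimately have "range (idx :: 'n \<Rightarrow> nat) = {..<CARD('n)}"
    by (intro card_subset_eq) auto
  with inj show ?thesis by (simp add: bij_betw_def)
qed

lemma idx_eq_iff: "idx i = idx j \<longleftrightarrow> i = (j :: 'n::{finite,linorder})"
  using bij_betw_idx[where 'n='n] by (auto simp: bij_betw_def inj_def)

lemma idx_less: "idx (i :: 'n::{finite,linorder}) < CARD('n)"
  using bij_betw_idx[where 'n='n] by (auto simp: bij_betw_def)

lemma sum_idx: "(\<Sum>l\<in>(UNIV::'n::{finite,linorder} set). g (idx l)) = (\<Sum>l<CARD('n). g l)"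
  by (rule sum.reindex_bij_betw[OF bij_betw_idx])

lemma haar_entry_sum:
  assumes "1 \<le> i" "i \<le> K"
  shows "(\<Sum>l\<le>K. haar_entry K i l) = 0"
    and "(\<Sum>l\<le>K. (haar_entry K i l)\<^sup>2) = real K + 1"
proof -
  have split: "{..K} = {..<i-1} \<union> {i-1} \<union> {i..K}"
    using assms by auto
  have gen: "(\<Sum>l\<le>K. f (haar_entry K i l)) =
      f (haar_s K i * haar_r K i) + (real K + 1 - real i) * f (haar_r K i)"
    if "f 0 = 0" for f :: "real \<Rightarrow> real"
  proof -
    have "(\<Sum>l\<le>K. f (haar_entry K i l)) =
        (\<Sum>l<i-1. f (haar_entry K i l)) + f (haar_entry K i (i-1)) + (\<Sum>l=i..K. f (haar_entry K i l))"
      unfolding split using assms by (subst sum.union_disjoint; auto)+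
    moreover have "(\<Sum>l<i-1. f (haar_entry K i l)) = 0"
      using assms that by (intro sum.neutral) (auto simp: haar_entry_def)
    moreover have "(\<Sum>l=i..K. f (haar_entry K i l)) = (\<Sum>l=i..K. f (haar_r K i))"
      using assms by (intro sum.cong) (auto simp: haar_entry_def)
    ultimately show ?thesis
      using assms by (simp add: of_nat_diff algebra_simps) (simp add: haar_entry_def mult.commute)
  qed
  show "(\<Sum>l\<le>K. haar_entry K i l) = 0"
    using gen[of "\<lambda>x. x"] by (simp add: haar_s_def algebra_simps)
  have s: "haar_s K i < 0" using assms by (simp add: haar_s_def)
  have pos: "(haar_s K i)\<^sup>2 - haar_s K i > 0"
    using s by (smt (verit) zero_le_power2)
  have r2: "(haar_r K i)\<^sup>2 = (real K + 1) / ((haar_s K i)\<^sup>2 - haar_s K i)"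
    unfolding haar_r_def using pos by simp
  have "(\<Sum>l\<le>K. (haar_entry K i l)\<^sup>2) = (haar_r K i)\<^sup>2 * ((haar_s K i)\<^sup>2 - haar_s K i)"
  proof -
    have "real K + 1 - real i = - haar_s K i" by (simp add: haar_s_def)
    then show ?thesis
      using gen[of "\<lambda>x. x\<^sup>2"] unfolding \<open>_ = - haar_s K i\<close>
      by (simp add: power_mult_distrib) (simp add: algebra_simps)
  qed
  also have "\<dots> = real K + 1"
    using pos by (simp add: r2)
  finally show "(\<Sum>l\<le>K. (haar_entry K i l)\<^sup>2) = real K + 1" .
qed

lemma haar_entry_orthogonal:
  assumes "i < j" "j \<le> K"
  shows "(\<Sum>l\<le>K. haar_entry K i l * haar_entry K j l) = 0"
proof -
  define c where "c = (if i = 0 then 1 else haar_r K i)"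
  have "(\<Sum>l\<le>K. haar_entry K i l * haar_entry K j l) = (\<Sum>l\<le>K. c * haar_entry K j l)"
    using assms by (intro sum.cong) (auto simp: haar_entry_def c_def)
  also have "\<dots> = 0"
    using haar_entry_sum(1)[of j K] assms by (simp add: sum_distrib_left[symmetric])
  finally show ?thesis .
qed

lemma haar_entry_gram:
  assumes "i \<le> K" "j \<le> K"
  shows "(\<Sum>l\<le>K. haar_entry K i l * haar_entry K j l) = (if i = j then real K + 1 else 0)"
proof (cases "i = j")
  case True
  then show ?thesis
    using haar_entry_sum(2)[of i K] assms
    by (cases "i = 0") (auto simp: power2_eq_square haar_entry_def)
next
  case False
  then show ?thesis
    using haar_entry_orthogonal[of i j K] haar_entry_orthogonal[of j i K] assms
    by (cases "i < j") (auto simp: mult.commute)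
qed

lemma haar_canonical_gram:
  "(haar_canonical :: 'n::{finite,linorder} sqmat) ** transpose haar_canonical = mat (real CARD('n))"
proof -
  obtain K where K: "CARD('n) = Suc K"
    by (metis zero_less_card_finite gr0_implies_Suc)
  have "(\<Sum>l\<in>UNIV. haar_entry K (idx i) (idx l) * haar_entry K (idx j) (idx (l::'n))) =
      (if i = j then real (Suc K) else 0)" for i j :: 'n
    using haar_entry_gram[of "idx i" K "idx j"] idx_less[of i] idx_less[of j]
    by (simp add: sum_idx[where g="\<lambda>l. haar_entry K (idx i) l * haar_entry K (idx j) l"]
        K lessThan_Suc_atMost less_Suc_eq_le idx_eq_iff)
  then show ?thesis
    by (simp add: vec_eq_iff matrix_matrix_mult_def transpose_def haar_canonical_def mat_def K)
qed

lemma one_block_orthogonal: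
  assumes "orthogonal_upto (CARD('n) - 1) R"
  shows "(one_block R :: 'n::{finite,linorder} sqmat) ** transpose (one_block R) = mat 1"
proof -
  obtain K where K: "CARD('n) = Suc K"
    by (metis zero_less_card_finite gr0_implies_Suc)
  define B where "B = (\<lambda>i j. if i = 0 \<and> j = 0 then 1 else if i = 0 \<or> j = 0 then 0 else R i j)"
  have split: "{..K} = insert 0 {1..K}" by auto
  have main: "(\<Sum>l\<le>K. B i l * B j l) = (if i = j then 1 else 0)" if "i \<le> K" "j \<le> K" for i j
  proof -
    have "(\<Sum>l\<le>K. B i l * B j l) = B i 0 * B j 0 + (\<Sum>l=1..K. B i l * B j l)"
      unfolding split by (subst sum.insert) auto
    also have "(\<Sum>l=1..K. B i l * B j l) =
        (if i = 0 \<or> j = 0 then 0 else (\<Sum>l=1..K. R i l * R j l))"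
      by (auto simp: B_def)
    finally show ?thesis
      using assms that by (auto simp: orthogonal_upto_def K B_def)
  qed
  have "(\<Sum>l\<in>UNIV. B (idx i) (idx l) * B (idx j) (idx (l::'n))) = (if i = j then 1 else 0)" for i j :: 'n
    using main[of "idx i" "idx j"] idx_less[of i] idx_less[of j]
    by (simp add: sum_idx[where g="\<lambda>l. B (idx i) l * B (idx j) l"]
        K lessThan_Suc_atMost less_Suc_eq_le idx_eq_iff)
  then show ?thesis
    by (simp add: vec_eq_iff matrix_matrix_mult_def transpose_def one_block_def mat_def B_def)
qed

lemma haar_type_gram:
  assumes "haar_type (A :: 'n::{finite,linorder} sqmat)"
  shows "A ** transpose A = mat (real CARD('n))"
proof -
  obtain R where R: "orthogonal_upto (CARD('n) - 1) R" "A = one_block R ** haar_canonical"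
    using assms by (auto simp: haar_type_def)
  have "A ** transpose A =
      one_block R ** (haar_canonical ** transpose haar_canonical) ** transpose (one_block R)"
    by (simp add: R(2) matrix_transpose_mul matrix_mul_assoc)
  also have "\<dots> = real CARD('n) *\<^sub>R (one_block R ** transpose (one_block R :: 'n sqmat))"
    unfolding haar_canonical_gram
    by (simp add: vec_eq_iff matrix_matrix_mult_def mat_def sum_distrib_left if_distrib[where f="\<lambda>x. _ * x"]
        sum.delta mult_ac cong: if_cong)
  also have "\<dots> = mat (real CARD('n))"
    unfolding one_block_orthogonal[OF R(1)] by (simp add: vec_eq_iff mat_def)
  finally show ?thesis .
qed

lemma orthogonal_haar_H:
  assumes "haar_type (A :: 'n::{finite,linorder} sqmat)"
  shows "orthogonal_matrix (haar_H A)"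
proof -
  have "haar_H A ** transpose (haar_H A) = (1 / real CARD('n)) *\<^sub>R (A ** transpose A)"
    by (simp add: vec_eq_iff haar_H_def matrix_matrix_mult_def transpose_def sum_distrib_left
        mult_ac flip: sum_divide_distrib)
  also have "\<dots> = mat 1"
    unfolding haar_type_gram[OF assms] by (simp add: vec_eq_iff mat_def)
  finally have "haar_H A ** transpose (haar_H A) = mat 1" .
  then show ?thesis
    by (metis matrix_left_right_inverse orthogonal_matrix_def)
qed

lemma law_integral: "(LINT \<xi>|law. f \<xi>) = (LINT \<xi>|lborel. indicator {0..1} \<xi> * f \<xi>)"
  if "f \<in> borel_measurable borel" for f :: "real \<Rightarrow> real"
proof -
  have "law = density lborel (\<lambda>x. ennreal (indicator {0..1} x))"
    unfolding law_def uniform_measure_def by (intro density_cong) (auto split: split_indicator)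
  then show ?thesis
    using that by (subst \<open>law = _\<close>, subst integral_real_density) auto
qed

lemma cell_measurable [measurable]: "cell (l :: 'n::{finite,linorder}) \<in> borel_measurable borel"
  unfolding cell_def[abs_def] by measurable

lemma cell_alt:
  "cell (l :: 'n::{finite,linorder}) = indicator {real (idx l) / real CARD('n) .. (real (idx l) + 1) / real CARD('n)}"
proof
  fix x
  have "real CARD('n) > 0" by simp
  then show "cell l x =
      indicator {real (idx l) / real CARD('n) .. (real (idx l) + 1) / real CARD('n)} x"
    unfolding cell_def indicator_def by (simp add: field_simps)
qed

lemma ip_cell3:
  "(LINT \<xi>|law. cell l \<xi> * (cell m \<xi> * cell (n :: 'n::{finite,linorder}) \<xi>)) =
     (if l = m \<and> m = n then 1 / real CARD('n) else 0)"
proof -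
  let ?N = "real CARD('n)"
  have N: "?N > 0" by simp
  have eq: "(LINT \<xi>|law. cell l \<xi> * (cell m \<xi> * cell n \<xi>)) =
      (LINT \<xi>|lborel. indicator {0..1} \<xi> * (cell l \<xi> * (cell m \<xi> * cell n \<xi>)))"
    by (rule law_integral) measurable
  show ?thesis
  proof (cases "l = m \<and> m = n")
    case True
    have "indicator {0..1} x * (cell l x * (cell m x * cell n x)) = cell n x" for x :: real
    proof -
      have "real (idx n) + 1 \<le> ?N" using idx_less[of n] by linarith
      then have up: "(real (idx n) + 1) / ?N \<le> 1" by simp
      have lo: "0 \<le> real (idx n) / ?N" by simp
      show ?thesis
        using True order_trans[OF lo, of x] order_trans[OF _ up, of x]
        unfolding cell_alt by (auto simp: indicator_def simp del: zero_le_divide_iff)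
    qed
    moreover have "(LINT \<xi>|lborel. cell n \<xi>) = 1 / ?N"
    proof -
      have "real (idx n) / ?N \<le> (real (idx n) + 1) / ?N" by (simp add: divide_right_mono)
      then show ?thesis unfolding cell_alt by (simp add: diff_divide_distrib[symmetric])
    qed
    ultimately show ?thesis using True unfolding eq by (simp only: if_True simp_thms)
  next
    case False
    then obtain a b where ab: "a \<noteq> b" "a \<in> {l,m,n}" "b \<in> {l,m,n}" "idx a < idx b"
      by (metis idx_eq_iff insertCI linorder_neqE_nat)
    have "indicator {0..1} x * (cell l x * (cell m x * cell n x)) = 0"
      if "x \<noteq> real (idx b) / ?N" for x :: real
    proof -
      have "cell a x * cell b x = 0"
      proof (rule ccontr)
        assume "cell a x * cell b x \<noteq> 0"
        then have "x \<le> (real (idx a) + 1) / ?N" "real (idx b) / ?N \<le> x"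
          unfolding cell_alt by (auto simp: indicator_def split: if_splits)
        moreover have "(real (idx a) + 1) / ?N \<le> real (idx b) / ?N"
          using ab(4) by (simp add: divide_right_mono)
        ultimately show False using that by linarith
      qed
      then show ?thesis using ab by auto
    qed
    then have "AE x in lborel. indicator {0..1} x * (cell l x * (cell m x * cell n x)) = (0::real)"
      using AE_lborel_singleton[of "real (idx b) / ?N"] by (auto elim: eventually_mono)
    then have "(LINT \<xi>|lborel. indicator {0..1} \<xi> * (cell l \<xi> * (cell m \<xi> * cell n \<xi>))) = 0"
      using integral_cong_AE[of "\<lambda>\<xi>. indicator {0..1} \<xi> * (cell l \<xi> * (cell m \<xi> * cell n \<xi>))" lborel "\<lambda>_. 0"]
      by simp
    then show ?thesis using False eq by simp
  qed
qed

lemma finite_measure_law: "finite_measure law"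
  by (rule finite_measureI) (simp add: law_def)

lemma sets_law [measurable_cong]: "sets law = sets borel"
  by (simp add: law_def)

lemma integrable_cell3:
  "integrable law (\<lambda>\<xi>. cell l \<xi> * (cell m \<xi> * cell (n :: 'n::{finite,linorder}) \<xi>))"
proof -
  interpret finite_measure law by (rule finite_measure_law)
  show ?thesis
    by (rule integrable_const_bound[of _ 1]) (auto simp: cell_def indicator_def)
qed

lemma triple_mat_entry:
  "triple_mat (A :: 'n::{finite,linorder} sqmat) k $ i $ j =
     (\<Sum>l\<in>UNIV. A $ k $ l * A $ i $ l * A $ j $ l) / real CARD('n)"
proof -
  have "triple_mat A k $ i $ j = (LINT \<xi>|law. (\<Sum>l\<in>UNIV. \<Sum>m\<in>UNIV. \<Sum>n\<in>UNIV.
      (A $ k $ l * A $ i $ m * A $ j $ n) * (cell l \<xi> * (cell m \<xi> * cell n \<xi>))))"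
    unfolding triple_mat_def ip_def
    by (simp only: vec_lambda_beta basis_fun_def sum_product) (simp only: sum_distrib_left mult_ac)
  also have "\<dots> = (\<Sum>l\<in>UNIV. \<Sum>m\<in>UNIV. \<Sum>n\<in>UNIV.
      (A $ k $ l * A $ i $ m * A $ j $ n) * (if l = m \<and> m = n then 1 / real CARD('n) else 0))"
    by (simp add: integrable_cell3 ip_cell3)
  also have "\<dots> = (\<Sum>l\<in>UNIV. A $ k $ l * A $ i $ l * A $ j $ l / real CARD('n))"
  proof (rule sum.cong[OF refl])
    fix l :: 'n
    have "(\<Sum>n\<in>UNIV. (A $ k $ l * A $ i $ m * A $ j $ n) * (if l = m \<and> m = n then 1 / real CARD('n) else 0)) =
        (if m = l then A $ k $ l * A $ i $ l * A $ j $ l / real CARD('n) else 0)" for m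
      by (cases "m = l") (auto simp: if_distrib[where f="\<lambda>x. _ * x"] cong: if_cong)
    then show "(\<Sum>m\<in>UNIV. \<Sum>n\<in>UNIV.
        (A $ k $ l * A $ i $ m * A $ j $ n) * (if l = m \<and> m = n then 1 / real CARD('n) else 0)) =
        A $ k $ l * A $ i $ l * A $ j $ l / real CARD('n)"
      by simp
  qed
  finally show ?thesis by (simp add: sum_divide_distrib)
qed

lemma galerkin_mat_entry:
  "galerkin_mat (A :: 'n::{finite,linorder} sqmat) w $ i $ j =
     (\<Sum>l\<in>UNIV. A $ i $ l * (\<Sum>k\<in>UNIV. w $ k * A $ k $ l) * A $ j $ l) / real CARD('n)"
proof -
  have "galerkin_mat A w $ i $ j =
      (\<Sum>k\<in>UNIV. \<Sum>l\<in>UNIV. w $ k * (A $ k $ l * A $ i $ l * A $ j $ l)) / real CARD('n)"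
    by (simp add: galerkin_mat_def triple_mat_entry sum_distrib_left sum_divide_distrib)
  also have "\<dots> = (\<Sum>l\<in>UNIV. \<Sum>k\<in>UNIV. w $ k * (A $ k $ l * A $ i $ l * A $ j $ l)) / real CARD('n)"
    by (subst sum.swap) (rule refl)
  finally show ?thesis
    by (simp add: sum_distrib_left sum_distrib_right mult_ac)
qed

definition diag_mat :: "('n \<Rightarrow> real) \<Rightarrow> 'n::finite sqmat" where
  "diag_mat d = (\<chi> i j. if i = j then d i else 0)"

lemma galerkin_mat_factor:
  "galerkin_mat (A :: 'n::{finite,linorder} sqmat) w =
     haar_H A ** diag_mat (\<lambda>l. \<Sum>k\<in>UNIV. w $ k * A $ k $ l) ** transpose (haar_H A)"
proof -
  have delta: "(\<Sum>m\<in>UNIV. x m * (if m = l then d m else 0)) = x l * d l" for x d :: "'n \<Rightarrow> real" and l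
  proof -
    have "(\<Sum>m\<in>UNIV. x m * (if m = l then d m else 0)) = (\<Sum>m\<in>UNIV. if m = l then x m * d m else 0)"
      by (rule sum.cong) auto
    then show ?thesis by simp
  qed
  have scale: "(1 / sqrt (real CARD('n)) * a) * d * (1 / sqrt (real CARD('n)) * b) = a * d * b / real CARD('n)"
    for a b d :: real
    by (simp add: field_simps)
  show ?thesis
    unfolding vec_eq_iff
    by (simp only: galerkin_mat_entry matrix_matrix_mult_def diag_mat_def haar_H_def transpose_def
        vec_lambda_beta vector_scaleR_component real_scaleR_def delta scale sum_divide_distrib simp_thms)
qed

lemma eig_mat_eq:
  assumes "haar_type (A :: 'n::{finite,linorder} sqmat)"
  shows "eig_mat A w = diag_mat (\<lambda>l. \<Sum>k\<in>UNIV. w $ k * A $ k $ l)"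
proof -
  have "transpose (haar_H A) ** haar_H A = mat 1"
    using orthogonal_haar_H[OF assms] by (simp add: orthogonal_matrix_def)
  moreover have "transpose (haar_H A) ** (haar_H A ** D ** transpose (haar_H A)) ** haar_H A =
      (transpose (haar_H A) ** haar_H A) ** D ** (transpose (haar_H A) ** haar_H A)" for D
    by (simp only: matrix_mul_assoc)
  ultimately show ?thesis
    unfolding eig_mat_def galerkin_mat_factor by simp
qed

lemma eig_mat_diagonal:
  assumes "haar_type A" "i \<noteq> j"
  shows "eig_mat A w $ i $ j = 0"
  using assms by (simp add: eig_mat_eq diag_mat_def)

lemma galerkin_mat_eq:
  assumes "haar_type A"
  shows "galerkin_mat A w = haar_H A ** eig_mat A w ** transpose (haar_H A)"
  using assms by (simp add: eig_mat_eq galerkin_mat_factor)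

end

theory Submission
  imports Defs
begin

text \<open>
  In \<open>L\<^sup>2\<close> the Haar-type basis spans the functions that are constant on the \<open>K + 1\<close> cells, and
  passing from the modes of such a function to its cell values turns the Galerkin product into the
  pointwise product. In cell values the Galerkin system is therefore \<open>K + 1\<close> uncoupled copies of the
  Euler equations. Its Jacobian is similar to the block diagonal matrix of the \<open>3 \<times> 3\<close> Euler
  Jacobians, each of which has an explicit eigenbasis with speeds \<open>v \<bullet> n \<plusminus> c\<close> and \<open>v \<bullet> n\<close>.
\<close>

section \<open>Cell values\<close>

text \<open>The value of \<open>expansion A w\<close> on cell \<open>l\<close> (see
  \<open>expansion_on_cell\<close>). For a Haar-type \<open>A\<close> it is also the
  \<open>l\<close>-th eigenvalue of the Galerkin matrix of \<open>w\<close>.\<close>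

definition cell_values :: "'n::{finite,linorder} sqmat \<Rightarrow> 'n rvec \<Rightarrow> 'n \<Rightarrow> real" where
  "cell_values A w l = (\<Sum>k\<in>UNIV. w $ k * A $ k $ l)"

text \<open>The divisor is the inverse of the length of a cell, so these are the modes of the step
  function with value \<open>d l\<close> on cell \<open>l\<close>.\<close>

definition from_cells :: "'n::{finite,linorder} sqmat \<Rightarrow> ('n \<Rightarrow> real) \<Rightarrow> 'n rvec" where
  "from_cells A d = (\<chi> k. (\<Sum>l\<in>UNIV. A $ k $ l * d l) / real CARD('n))"

text \<open>The block matrix leaves row 0 of the canonical matrix alone. Hence \<open>e1\<close>
  represents the constant 1, which starts the Galerkin powers.\<close>

lemma haar_type_first_row:
  fixes A :: "'n::{finite,linorder} sqmat"
  assumes "haar_type A" "idx k = 0"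
  shows "A $ k $ l = 1"
proof -
  obtain R where A: "A = one_block R ** haar_canonical"
    using assms(1) by (auto simp: haar_type_def)
  have "A $ k $ l = (\<Sum>j\<in>UNIV. if j = k then (1::real) else 0)"
    unfolding A matrix_matrix_mult_def vec_lambda_beta
    by (rule sum.cong)
       (use assms(2) in \<open>auto simp: one_block_def haar_canonical_def haar_entry_def simp flip: idx_eq_iff\<close>)
  then show ?thesis by simp
qed

lemma haar_type_row_sum:
  fixes A :: "'n::{finite,linorder} sqmat"
  assumes "haar_type A"
  shows "(\<Sum>l\<in>UNIV. A $ i $ l * A $ j $ l) = (if i = j then real CARD('n) else 0)"
  using haar_type_gram[OF assms]
  by (simp add: vec_eq_iff matrix_matrix_mult_def transpose_def mat_def)

text \<open>For a square matrix orthogonality of the rows implies that of the columns;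
  \<open>orthogonal_haar_H\<close> contains both sides.\<close>

lemma haar_type_column_sum:
  fixes A :: "'n::{finite,linorder} sqmat"
  assumes "haar_type A"
  shows "(\<Sum>k\<in>UNIV. A $ k $ l * A $ k $ m) = (if l = m then real CARD('n) else 0)"
proof -
  have "(transpose (haar_H A) ** haar_H A) $ l $ m = mat 1 $ l $ m"
    using orthogonal_haar_H[OF assms] by (simp add: orthogonal_matrix_def)
  then have "(\<Sum>k\<in>UNIV. A $ k $ l * A $ k $ m) / real CARD('n) = (if l = m then 1 else 0)"
    by (simp add: matrix_matrix_mult_def transpose_def haar_H_def mat_def sum_divide_distrib)
  then show ?thesis by (auto split: if_splits)
qed

text \<open>Column orthogonality here and row orthogonality in the next lemma make the passage
  between modes and cell values a bijection.\<close>

lemma cell_values_from_cells [simp]: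
  assumes "haar_type (A :: 'n::{finite,linorder} sqmat)"
  shows "cell_values A (from_cells A d) = d"
proof
  fix l
  have "cell_values A (from_cells A d) l =
      (\<Sum>k\<in>UNIV. \<Sum>m\<in>UNIV. d m * (A $ k $ m * A $ k $ l)) / real CARD('n)"
    by (simp add: cell_values_def from_cells_def sum_divide_distrib sum_distrib_left
        sum_distrib_right mult_ac)
  also have "\<dots> = (\<Sum>m\<in>UNIV. d m * (\<Sum>k\<in>UNIV. A $ k $ m * A $ k $ l)) / real CARD('n)"
    by (subst sum.swap) (simp add: sum_distrib_left)
  also have "\<dots> = d l"
    by (simp add: haar_type_column_sum[OF assms] if_distrib[where f="\<lambda>x. _ * x"] cong: if_cong)
  finally show "cell_values A (from_cells A d) l = d l" .
qed

lemma from_cells_cell_values [simp]: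
  assumes "haar_type (A :: 'n::{finite,linorder} sqmat)"
  shows "from_cells A (cell_values A w) = w"
proof -
  have "from_cells A (cell_values A w) $ k = w $ k" for k
  proof -
    have "from_cells A (cell_values A w) $ k =
        (\<Sum>l\<in>UNIV. \<Sum>j\<in>UNIV. w $ j * (A $ k $ l * A $ j $ l)) / real CARD('n)"
      by (simp add: cell_values_def from_cells_def sum_divide_distrib sum_distrib_left
          sum_distrib_right mult_ac)
    also have "\<dots> = (\<Sum>j\<in>UNIV. w $ j * (\<Sum>l\<in>UNIV. A $ k $ l * A $ j $ l)) / real CARD('n)"
      by (subst sum.swap) (simp add: sum_distrib_left)
    also have "\<dots> = w $ k"
      by (simp add: haar_type_row_sum[OF assms] if_distrib[where f="\<lambda>x. _ * x"] cong: if_cong)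
    finally show ?thesis .
  qed
  then show ?thesis by (simp add: vec_eq_iff)
qed

lemma from_cells_add: "from_cells A (\<lambda>l. a l + b l) = from_cells A a + from_cells A b"
  by (simp add: from_cells_def vec_eq_iff sum.distrib algebra_simps add_divide_distrib)

lemma from_cells_scale: "from_cells A (\<lambda>l. r * a l) = r *\<^sub>R from_cells A a"
  by (simp add: from_cells_def vec_eq_iff sum_distrib_left mult_ac)

section \<open>The Galerkin operations in cell values\<close>

lemma ex_first_index: "\<exists>k::'n::{finite,linorder}. idx k = 0"
proof -
  have "0 \<in> range (idx :: 'n \<Rightarrow> nat)"
    using bij_betw_idx[where 'n='n] by (simp add: bij_betw_def)
  then show ?thesis by fastforce
qed

lemma cell_values_e1:
  assumes "haar_type (A :: 'n::{finite,linorder} sqmat)"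
  shows "cell_values A e1 l = 1"
proof -
  obtain k0 :: 'n where k0: "idx k0 = 0" using ex_first_index by blast
  have "cell_values A e1 l = (\<Sum>k\<in>UNIV. if k = k0 then 1 else 0)"
    unfolding cell_values_def
    by (rule sum.cong) (auto simp: e1_def haar_type_first_row[OF assms] simp flip: k0 idx_eq_iff)
  then show ?thesis by simp
qed

text \<open>The vector \<open>transpose (haar_H A) *v e1\<close> is constant, and its entry together
  with the scaling of the outer \<open>haar_H A\<close> gives the cell length. This translates the
  formulas defining \<open>nu1\<close>, \<open>nu2\<close> and \<open>p_hat\<close> into cell
  values.\<close>

lemma haar_H_diag_e1:
  assumes "haar_type (A :: 'n::{finite,linorder} sqmat)"
  shows "haar_H A ** diag_mat d ** transpose (haar_H A) *v e1 = from_cells A d"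
proof -
  have 1: "transpose (haar_H A) *v e1 = (\<chi> l. 1 / sqrt (real CARD('n)))"
  proof -
    have "(\<Sum>k\<in>UNIV. A $ k $ l * e1 $ k) = 1" for l
      using cell_values_e1[OF assms, of l] by (simp add: cell_values_def mult.commute)
    then show ?thesis
      by (simp add: vec_eq_iff matrix_vector_mult_def transpose_def haar_H_def
          flip: sum_divide_distrib)
  qed
  have 2: "diag_mat d *v x = (\<chi> l. d l * x $ l)" for x :: "'n rvec"
    by (simp add: vec_eq_iff matrix_vector_mult_def diag_mat_def
        if_distrib[where f="\<lambda>x. x * _"] cong: if_cong)
  show ?thesis
    unfolding matrix_vector_mul_assoc[symmetric] 1 2
    by (simp add: vec_eq_iff matrix_vector_mult_def haar_H_def from_cells_def sum_divide_distrib)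
qed

lemma eig_mat_cell_values:
  "haar_type A \<Longrightarrow> eig_mat A w = diag_mat (cell_values A w)"
  by (simp add: eig_mat_eq cell_values_def[abs_def])

text \<open>The entry formula is already a single sum over cells. Once the sums are exchanged, the
  inner sum over \<open>j\<close> is the cell value of \<open>q\<close>, which leaves a pointwise
  product.\<close>

lemma galerkin_mat_mult:
  assumes "haar_type (A :: 'n::{finite,linorder} sqmat)"
  shows "galerkin_mat A w *v q = from_cells A (\<lambda>l. cell_values A w l * cell_values A q l)"
proof -
  have "(galerkin_mat A w *v q) $ i =
      (\<Sum>j\<in>UNIV. \<Sum>l\<in>UNIV. A $ i $ l * (cell_values A w l * (q $ j * A $ j $ l))) / real CARD('n)" for i
    by (simp add: matrix_vector_mult_def galerkin_mat_entry cell_values_def[symmetric]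
        sum_divide_distrib sum_distrib_left sum_distrib_right mult_ac)
  then have "(galerkin_mat A w *v q) $ i =
      (\<Sum>l\<in>UNIV. \<Sum>j\<in>UNIV. A $ i $ l * (cell_values A w l * (q $ j * A $ j $ l))) / real CARD('n)" for i
    by (subst sum.swap) simp
  then show ?thesis
    by (simp add: vec_eq_iff from_cells_def sum_distrib_left cell_values_def[of A q])
qed

lemma gprod_eq:
  "haar_type A \<Longrightarrow> gprod A w q = from_cells A (\<lambda>l. cell_values A w l * cell_values A q l)"
  by (simp add: gprod_def galerkin_mat_mult)

lemma gpow_2_eq:
  "haar_type A \<Longrightarrow> gpow A w 2 = from_cells A (\<lambda>l. (cell_values A w l)\<^sup>2)"
  by (simp add: gpow_def numeral_2_eq_2 galerkin_mat_mult cell_values_e1 power2_eq_square)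

text \<open>The modes of the indicator of one cell form an eigenvector of the Galerkin matrix, with
  the cell value as eigenvalue. Positive definiteness is tested on this vector.\<close>

lemma pos_states_cell_values:
  assumes "haar_type (A :: 'n::{finite,linorder} sqmat)" "w \<in> pos_states A"
  shows "0 < cell_values A w l"
proof -
  define v where "v = from_cells A (\<lambda>m. if m = l then 1 else 0)"
  have v: "cell_values A v = (\<lambda>m. if m = l then 1 else 0)"
    by (simp add: v_def assms(1))
  have "v \<noteq> 0"
  proof
    assume "v = 0"
    then have "cell_values A v l = 0" by (simp add: cell_values_def)
    then show False by (simp add: v)
  qed
  then have "0 < v \<bullet> (galerkin_mat A w *v v)"
    using assms(2) by (simp add: pos_states_def pos_def_def)
  also have "galerkin_mat A w *v v = cell_values A w l *\<^sub>R v"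
    unfolding galerkin_mat_mult[OF assms(1)] v
    by (subst v_def, subst from_cells_scale[symmetric]) (rule arg_cong[of _ _ "from_cells A"], auto)
  finally have "0 < cell_values A w l * (v \<bullet> v)" by simp
  then show ?thesis
    using inner_ge_zero[of v] by (simp add: zero_less_mult_iff)
qed

lemma diag_mat_mult: "diag_mat a ** diag_mat b = diag_mat (\<lambda>l. a l * b l)"
  by (simp add: vec_eq_iff matrix_matrix_mult_def diag_mat_def
        if_distrib[where f="\<lambda>x. x * _"] if_distrib[where f="\<lambda>x. _ * x"] cong: if_cong)

text \<open>\<open>matrix_inv\<close> chooses some two-sided inverse, so an explicit one is
  identified with it by uniqueness.\<close>

lemma matrix_inv_eqI:
  fixes M :: "'a::semiring_1^'n^'m"
  assumes "M ** B = mat 1" "B ** M = mat 1"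
  shows "matrix_inv M = B"
proof -
  have "M ** matrix_inv M = mat 1 \<and> matrix_inv M ** M = mat 1"
    unfolding matrix_inv_def by (rule someI_ex) (use assms in blast)
  then show ?thesis
    by (metis assms(2) matrix_mul_assoc matrix_mul_lid matrix_mul_rid)
qed

lemma diag_mat_inverse:
  fixes d :: "'n::finite \<Rightarrow> real"
  assumes "\<And>l. d l \<noteq> 0"
  shows "invertible (diag_mat d)" "matrix_inv (diag_mat d) = diag_mat (\<lambda>l. 1 / d l)"
proof -
  have one: "diag_mat (\<lambda>l. 1) = (mat 1 :: 'n sqmat)"
    by (simp add: vec_eq_iff diag_mat_def mat_def)
  have "diag_mat d ** diag_mat (\<lambda>l. 1 / d l) = mat 1"
       "diag_mat (\<lambda>l. 1 / d l) ** diag_mat d = mat 1"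
    using assms by (simp_all add: diag_mat_mult one)
  then show "invertible (diag_mat d)" "matrix_inv (diag_mat d) = diag_mat (\<lambda>l. 1 / d l)"
    by (auto simp: invertible_def intro: matrix_inv_eqI)
qed

lemma D_nu_eq:
  assumes "haar_type A" "\<And>l. cell_values A (block 1 u) l \<noteq> 0"
  shows "D_nu A c u = diag_mat (\<lambda>l. cell_values A (block c u) l / cell_values A (block 1 u) l)"
  using assms by (simp add: D_nu_def eig_mat_cell_values diag_mat_inverse diag_mat_mult)

lemma diag_powr_diag_mat: "diag_powr (diag_mat d) a = diag_mat (\<lambda>l. d l powr a)"
  by (simp add: diag_powr_def diag_mat_def vec_eq_iff)

section \<open>States and Galerkin fluxes cell by cell\<close>

definition cell_state :: "'n::{finite,linorder} sqmat \<Rightarrow> 'n state \<Rightarrow> 'n \<Rightarrow> real^3" where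
  "cell_state A u l = (\<chi> c. cell_values A (block c u) l)"

definition from_cell_states :: "'n::{finite,linorder} sqmat \<Rightarrow> ('n \<Rightarrow> real^3) \<Rightarrow> 'n state" where
  "from_cell_states A s = stack (\<chi> c. from_cells A (\<lambda>l. s l $ c))"

lemma block_stack [simp]: "block c (stack B) = B $ c"
  by (simp add: block_def stack_def vec_eq_iff)

lemma state_eqI: "(\<And>c. block c u = block c v) \<Longrightarrow> u = v"
  by (auto simp: block_def vec_eq_iff)

lemma block_from_cell_states [simp]:
  "block c (from_cell_states A s) = from_cells A (\<lambda>l. s l $ c)"
  by (simp add: from_cell_states_def)

lemma from_cell_states_cell_state [simp]:
  "haar_type A \<Longrightarrow> from_cell_states A (cell_state A u) = u"
  by (rule state_eqI) (simp add: cell_state_def)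

lemma nu_eq:
  assumes "haar_type A" "\<And>l. cell_values A (block 1 u) l \<noteq> 0"
  shows "cell_values A (nu1 A u) l = cell_state A u l $ 2 / cell_state A u l $ 1"
    and "cell_values A (nu2 A u) l = cell_state A u l $ 3 / cell_state A u l $ 1"
  using assms by (simp_all add: nu1_def nu2_def D_nu_eq haar_H_diag_e1 cell_state_def)

lemma p_hat_eq:
  "haar_type A \<Longrightarrow> p_hat A \<gamma> w = from_cells A (\<lambda>l. cell_values A w l powr \<gamma>)"
  by (simp add: p_hat_def eig_mat_cell_values diag_powr_diag_mat haar_H_diag_e1)

text \<open>In cell values \<open>nu1\<close> and \<open>nu2\<close> are the velocities, and in each
  product of velocities with the density one density cancels. The identity is stated on the set of
  nonvanishing cell densities, which is open, so that it can be differentiated.\<close>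

lemma f_hat_eq:
  assumes "haar_type A" "\<And>l. cell_values A (block 1 u) l \<noteq> 0"
  shows "f_hat1 A \<gamma> u = from_cell_states A (\<lambda>l. euler_flux1 \<gamma> (cell_state A u l))"
    and "f_hat2 A \<gamma> u = from_cell_states A (\<lambda>l. euler_flux2 \<gamma> (cell_state A u l))"
proof -
  have 1: "cell_values A (block c u) l = cell_state A u l $ c" for c l
    by (simp add: cell_state_def)
  have 2: "from_cells A (\<lambda>l. cell_state A u l $ c) = block c u" for c
    using assms(1) by (simp add: cell_state_def)
  have nz: "cell_state A u l $ 1 \<noteq> 0" for l
    using assms(2) by (simp add: 1)
  show "f_hat1 A \<gamma> u = from_cell_states A (\<lambda>l. euler_flux1 \<gamma> (cell_state A u l))"
  proof (rule state_eqI)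
    fix c :: 3
    show "block c (f_hat1 A \<gamma> u) =
        block c (from_cell_states A (\<lambda>l. euler_flux1 \<gamma> (cell_state A u l)))"
      using exhaust_3[of c] assms nz
      by (auto simp: f_hat1_def euler_flux1_def gprod_eq gpow_2_eq p_hat_eq nu_eq 1 2
          from_cells_add power2_eq_square)
  qed
  show "f_hat2 A \<gamma> u = from_cell_states A (\<lambda>l. euler_flux2 \<gamma> (cell_state A u l))"
  proof (rule state_eqI)
    fix c :: 3
    show "block c (f_hat2 A \<gamma> u) =
        block c (from_cell_states A (\<lambda>l. euler_flux2 \<gamma> (cell_state A u l)))"
      using exhaust_3[of c] assms nz
      by (auto simp: f_hat2_def euler_flux2_def gprod_eq gpow_2_eq p_hat_eq nu_eq 1 2
          from_cells_add power2_eq_square)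
  qed
qed

section \<open>Modes of cellwise constant functions\<close>

text \<open>The cells are closed intervals and neighbours overlap in a grid point. Away from the
  finite grid every point of the unit interval lies in exactly one cell.\<close>

lemma AE_cell_partition:
  "AE \<xi> in law. \<exists>l. \<forall>m. cell (m :: 'n::{finite,linorder}) \<xi> = (if m = l then 1 else 0)"
proof -
  let ?N = "real CARD('n)"
  define E where "E = (\<lambda>i. real i / ?N) ` {..CARD('n)}"
  have N: "?N > 0" by simp
  have ex: "\<exists>l. \<forall>m::'n. cell m \<xi> = (if m = l then 1 else 0)" if "\<xi> \<in> {0..1}" "\<xi> \<notin> E" for \<xi>
  proof -
    \<comment> \<open>Scaled by the number of cells, the cells have integer end points, so the floor
      is the index of the cell that contains the point.\<close>
    define j where "j = nat \<lfloor>?N * \<xi>\<rfloor>"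
    have not_nat: "?N * \<xi> \<noteq> real i" if "i \<le> CARD('n)" for i
      using \<open>\<xi> \<notin> E\<close> that N by (force simp: E_def field_simps)
    \<comment> \<open>At the right end point 1 the floor would exceed the largest index; this point
      belongs to the grid \<open>E\<close> and is excluded.\<close>
    have "?N * \<xi> \<le> ?N" using that(1) by (simp add: mult_left_le)
    with not_nat[of "CARD('n)"] have lt: "?N * \<xi> < ?N" by linarith
    have nonneg: "0 \<le> ?N * \<xi>" using that(1) by simp
    have j: "real j \<le> ?N * \<xi>" "?N * \<xi> < real j + 1"
      unfolding j_def using nonneg by linarith+
    with lt have "j < CARD('n)" by linarith
    then obtain l :: 'n where l: "idx l = j"
      using bij_betw_idx[where 'n='n] by (metis bij_betw_def imageE lessThan_iff)
    have "cell m \<xi> = (if m = l then 1 else 0)" for m :: 'n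
    proof (cases "m = l")
      case True
      then show ?thesis using j l by (simp add: cell_def)
    next
      case False
      then have "idx m \<noteq> j" using l by (simp add: idx_eq_iff flip: l)
      moreover have "?N * \<xi> \<noteq> real (idx m)" "?N * \<xi> \<noteq> real (Suc (idx m))"
        using not_nat[of "idx m"] not_nat[of "Suc (idx m)"] idx_less[of m] by simp_all
      ultimately have "\<not> (real (idx m) \<le> ?N * \<xi> \<and> ?N * \<xi> \<le> real (idx m) + 1)"
        using j by (cases "idx m < j") auto
      then show ?thesis using False by (auto simp: cell_def indicator_def)
    qed
    then show ?thesis by blast
  qed
  have "E \<in> null_sets lborel"
    by (rule finite_imp_null_set_lborel) (simp add: E_def)
  then have "AE \<xi> in lborel. \<xi> \<notin> E" by (rule AE_not_in)
  then have "AE \<xi> in lborel. \<xi> \<in> {0..1} \<longrightarrow> (\<exists>l. \<forall>m::'n. cell m \<xi> = (if m = l then 1 else 0))"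
    by eventually_elim (intro impI ex)
  then show ?thesis
    unfolding law_def by (rule AE_uniform_measureI[rotated]) simp
qed

lemma cell_integral:
  "integrable law (cell (l :: 'n::{finite,linorder}))"
  "(LINT \<xi>|law. cell l \<xi>) = 1 / real CARD('n)"
proof -
  \<comment> \<open>An indicator equals its cube, so the known integrals of triple products apply
    with three equal indices.\<close>
  have cube: "(\<lambda>\<xi>. cell l \<xi> * (cell l \<xi> * cell l \<xi>)) = cell l"
    by (auto simp: cell_def indicator_def)
  show "integrable law (cell l)" "(LINT \<xi>|law. cell l \<xi>) = 1 / real CARD('n)"
    using integrable_cell3[of l l l] ip_cell3[of l l l] unfolding cube by simp_all
qed

lemma basis_fun_measurable [measurable]: "basis_fun A k \<in> borel_measurable borel"
  unfolding basis_fun_def[abs_def] by measurable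

lemma expansion_measurable [measurable]: "expansion A w \<in> borel_measurable borel"
  unfolding expansion_def[abs_def] by measurable

text \<open>Agreement with the step function is asked only at points that lie in exactly one cell.
  Since almost all points do, the square of \<open>g\<close> and its products with basis functions
  are almost everywhere linear combinations of the integrable functions
  \<open>cell l\<close>.\<close>

lemma square_integrable_and_modes:
  fixes A :: "'n::{finite,linorder} sqmat"
  assumes g: "g \<in> borel_measurable borel"
    and step: "\<And>\<xi> l. (\<And>m. cell m \<xi> = (if m = l then 1 else 0)) \<Longrightarrow> g \<xi> = d l"
  shows "square_integrable g" "modes A g = from_cells A d"
proof -
  note [measurable] = g
  \<comment> \<open>At a point of exactly one cell the sum collapses to one term. This is applied to
    the square of \<open>g\<close> and to the product of \<open>g\<close> with a basis
    function.\<close>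
  have AE: "AE \<xi> in law. h \<xi> = (\<Sum>l\<in>UNIV. e l * cell l \<xi>)"
    if "\<And>\<xi> l. (\<And>m. cell (m::'n) \<xi> = (if m = l then 1 else 0)) \<Longrightarrow> h \<xi> = e l" for h e
    using AE_cell_partition[where 'n='n]
  proof eventually_elim
    case (elim \<xi>)
    then obtain l where l: "\<And>m::'n. cell m \<xi> = (if m = l then 1 else 0)" by blast
    show ?case using that[OF l] by (simp add: l if_distrib[where f="\<lambda>x. _ * x"] cong: if_cong)
  qed
  have sq: "AE \<xi> in law. (g \<xi>)\<^sup>2 = (\<Sum>l\<in>UNIV. (d l)\<^sup>2 * cell l \<xi>)"
    by (rule AE) (simp add: step)
  have "integrable law (\<lambda>\<xi>. \<Sum>l\<in>UNIV. (d l)\<^sup>2 * cell l \<xi>)"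
    by (intro Bochner_Integration.integrable_sum integrable_mult_right cell_integral)
  then have "integrable law (\<lambda>\<xi>. (g \<xi>)\<^sup>2)"
    by (subst integrable_cong_AE[OF _ _ sq]) measurable
  then show "square_integrable g" by (simp add: square_integrable_def)
  have "ip g (basis_fun A k) = (\<Sum>l\<in>UNIV. A $ k $ l * d l) / real CARD('n)" for k
  proof -
    have eq: "AE \<xi> in law. g \<xi> * basis_fun A k \<xi> = (\<Sum>l\<in>UNIV. (A $ k $ l * d l) * cell l \<xi>)"
      by (rule AE) (simp add: step basis_fun_def if_distrib[where f="\<lambda>x. _ * x"] cong: if_cong)
    have "ip g (basis_fun A k) = (LINT \<xi>|law. (\<Sum>l\<in>UNIV. (A $ k $ l * d l) * cell l \<xi>))"
      unfolding ip_def by (rule integral_cong_AE[OF _ _ eq]) measurable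
    also have "\<dots> = (\<Sum>l\<in>UNIV. (A $ k $ l * d l) * (1 / real CARD('n)))"
      by (simp add: cell_integral)
    finally show ?thesis by (simp add: sum_divide_distrib)
  qed
  then show "modes A g = from_cells A d"
    by (simp add: modes_def from_cells_def)
qed

lemma expansion_on_cell:
  fixes A :: "'n::{finite,linorder} sqmat"
  assumes "\<And>m::'n. cell m \<xi> = (if m = l then 1 else 0)"
  shows "expansion A w \<xi> = cell_values A w l"
  by (simp add: expansion_def basis_fun_def cell_values_def assms
      if_distrib[where f="\<lambda>x. _ * x"] cong: if_cong)

lemma random_state_on_cell:
  fixes A :: "'n::{finite,linorder} sqmat"
  assumes "\<And>m::'n. cell m \<xi> = (if m = l then 1 else 0)"
  shows "random_state A u \<xi> = cell_state A u l"
  using assms by (simp add: random_state_def cell_state_def expansion_on_cell)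

lemma euler_flux_random_state_measurable:
  "(\<lambda>\<xi>. euler_flux1 \<gamma> (random_state A u \<xi>) $ c) \<in> borel_measurable borel"
  "(\<lambda>\<xi>. euler_flux2 \<gamma> (random_state A u \<xi>) $ c) \<in> borel_measurable borel"
proof -
  show "(\<lambda>\<xi>. euler_flux1 \<gamma> (random_state A u \<xi>) $ c) \<in> borel_measurable borel"
    using exhaust_3[of c] by (elim disjE) (simp_all add: euler_flux1_def random_state_def)
  show "(\<lambda>\<xi>. euler_flux2 \<gamma> (random_state A u \<xi>) $ c) \<in> borel_measurable borel"
    using exhaust_3[of c] by (elim disjE) (simp_all add: euler_flux2_def random_state_def)
qed

text \<open>The random state is constant on each cell up to grid points, hence so is its flux, and
  projecting it means taking the modes of a step function.\<close>

lemma projected_euler_flux: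
  "projected_flux A (euler_flux1 \<gamma>) u = from_cell_states A (\<lambda>l. euler_flux1 \<gamma> (cell_state A u l))"
  "projected_flux A (euler_flux2 \<gamma>) u = from_cell_states A (\<lambda>l. euler_flux2 \<gamma> (cell_state A u l))"
  unfolding projected_flux_def from_cell_states_def
  by (intro arg_cong[of _ _ stack] arg_cong[of _ _ vec_lambda] ext square_integrable_and_modes
      euler_flux_random_state_measurable; simp add: random_state_on_cell)+

text \<open>A derivative depends only on values near the point, and in an open set every coordinate
  line stays inside for a short while. The fluxes therefore need to agree only along the
  solution.\<close>

lemma conservation_law_cong:
  assumes "open \<Omega>" "\<And>z. z \<in> \<Omega> \<Longrightarrow> F1 (U z) = G1 (U z)" "\<And>z. z \<in> \<Omega> \<Longrightarrow> F2 (U z) = G2 (U z)"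
  shows "conservation_law F1 F2 \<Omega> U \<longleftrightarrow> conservation_law G1 G2 \<Omega> U"
proof -
  have slice: "(f has_vector_derivative b) (at s) \<longleftrightarrow> (g has_vector_derivative b) (at s)"
    if "continuous_on UNIV p" "p s \<in> \<Omega>" "\<And>r. p r \<in> \<Omega> \<Longrightarrow> f r = g r"
    for p :: "real \<Rightarrow> real \<times> real \<times> real" and f g :: "real \<Rightarrow> 's::real_normed_vector" and b s
  proof -
    have "open (p -` \<Omega>)" using open_vimage[OF assms(1) that(1)] .
    then show ?thesis
      using that(2,3)
      by (auto intro: has_vector_derivative_transform_within_open[of _ _ _ "p -` \<Omega>"])
  qed
  have "((\<lambda>s. F1 (U (t, s, y))) has_vector_derivative b) (at x) \<longleftrightarrow>
        ((\<lambda>s. G1 (U (t, s, y))) has_vector_derivative b) (at x)"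
       "((\<lambda>s. F2 (U (t, x, s))) has_vector_derivative b) (at y) \<longleftrightarrow>
        ((\<lambda>s. G2 (U (t, x, s))) has_vector_derivative b) (at y)"
    if "(t, x, y) \<in> \<Omega>" for t x y b
    using that
    by (intro slice[of "\<lambda>s. (t, s, y)"] slice[of "\<lambda>s. (t, x, s)"] continuous_intros; simp add: assms)+
  then show ?thesis
    unfolding conservation_law_def by (auto split: prod.splits)
qed

section \<open>Spectra of diagonalised matrices\<close>

text \<open>The embedding of real into complex matrices respects products, a scalar matrix is fixed
  by conjugation, and the determinant is multiplicative. Only the diagonal factor remains.\<close>

lemma char_fun_diagonalised:
  fixes P Q :: "real^'m^'m"
  assumes "P ** Q = mat 1"
  shows "char_fun (P ** diag_mat d ** Q) z = (\<Prod>p\<in>UNIV. z - complex_of_real (d p))"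
proof -
  let ?c = "map_matrix complex_of_real :: real^'m^'m \<Rightarrow> complex^'m^'m"
  have hom: "?c (X ** Y) = ?c X ** ?c Y" for X Y
    by (simp add: vec_eq_iff matrix_matrix_mult_def)
  have PQ: "?c P ** ?c Q = mat 1"
    unfolding hom[symmetric] assms by (simp add: vec_eq_iff mat_def)
  have mid: "?c P ** mat z ** ?c Q = mat z"
  proof -
    have "?c P ** mat z ** ?c Q = (\<chi> i j. z * (?c P ** ?c Q) $ i $ j)"
      by (simp add: vec_eq_iff matrix_matrix_mult_def mat_def sum_distrib_left mult_ac
          if_distrib[where f="\<lambda>x. x * _"] if_distrib[where f="\<lambda>x. _ * x"] cong: if_cong)
    also have "\<dots> = mat z"
      unfolding PQ by (simp add: vec_eq_iff mat_def)
    finally show ?thesis .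
  qed
  have "mat z - ?c (P ** diag_mat d ** Q) = ?c P ** (mat z - ?c (diag_mat d)) ** ?c Q"
  proof -
    have "X ** (Y - Z) = X ** Y - X ** Z" "(Y - Z) ** X = Y ** X - Z ** X" for X Y Z :: "complex^'m^'m"
      by (simp_all add: vec_eq_iff matrix_matrix_mult_def sum_subtractf algebra_simps)
    then show ?thesis unfolding hom by (simp add: mid)
  qed
  then have "char_fun (P ** diag_mat d ** Q) z =
      det (?c P ** ?c Q) * det (mat z - ?c (diag_mat d))"
    by (simp add: char_fun_def det_mul)
  also have "det (mat z - ?c (diag_mat d)) = (\<Prod>p\<in>UNIV. z - complex_of_real (d p))"
    by (subst det_diagonal) (simp_all add: diag_mat_def mat_def)
  finally show ?thesis by (simp add: PQ)
qed

lemma mat_mult_vector: "mat z *v v = z *s (v :: 'a::semiring_1^'m)"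
  by (simp add: vec_eq_iff matrix_vector_mult_def mat_def
      if_distrib[where f="\<lambda>x. x * _"] cong: if_cong)

lemma eigenvalues_char_fun: "eigenvalues M = {z. char_fun M z = 0}"
proof -
  let ?M = "map_matrix complex_of_real M"
  have "z \<in> eigenvalues M \<longleftrightarrow> (\<exists>v. v \<noteq> 0 \<and> (mat z - ?M) *v v = 0)" for z
    unfolding eigenvalues_def
    by (auto simp: matrix_vector_mult_diff_rdistrib mat_mult_vector)
  also have "\<dots> z \<longleftrightarrow> \<not> invertible (mat z - ?M)" for z
    using matrix_left_invertible_ker[of "mat z - ?M"]
    by (metis invertible_left_inverse)
  also have "\<dots> z \<longleftrightarrow> char_fun M z = 0" for z
    by (simp add: char_fun_def invertible_det_nz)
  finally show ?thesis by auto
qed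

section \<open>The Jacobian\<close>

lemma has_derivative_vecI:
  fixes f :: "'a::real_normed_vector \<Rightarrow> real^'m"
  assumes "\<And>i. ((\<lambda>x. f x $ i) has_derivative (\<lambda>h. f' h $ i)) (at x)"
  shows "(f has_derivative f') (at x)"
  by (rule has_derivative_componentwise_within[THEN iffD2])
     (use assms in \<open>auto simp: Basis_vec_def inner_axis\<close>)

lemma linear_cell_state: "linear (\<lambda>u. cell_state A u l)"
  by (rule linearI)
     (simp_all add: cell_state_def cell_values_def block_def vec_eq_iff sum.distrib
       sum_distrib_left algebra_simps)

lemma linear_from_cell_states:
  assumes "\<And>l. linear (\<lambda>x. s x l)"
  shows "linear (\<lambda>x. from_cell_states A (s x))"
  by (rule linearI)
     (simp_all add: from_cell_states_def from_cells_def stack_def vec_eq_iff sum.distrib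
       sum_distrib_left linear_add[OF assms] linear_scale[OF assms] algebra_simps add_divide_distrib)

text \<open>Chain rule: \<open>F\<close> on each cell stands between the linear maps
  \<open>cell_state\<close> and \<open>from_cell_states\<close>. Its derivative varies with the cell
  because it is taken at the state of that cell.\<close>

lemma has_derivative_cellwise:
  fixes A :: "'n::{finite,linorder} sqmat"
  assumes "\<And>l. (F has_derivative F' l) (at (cell_state A u l))"
  shows "((\<lambda>u. from_cell_states A (\<lambda>l. F (cell_state A u l))) has_derivative
    (\<lambda>h. from_cell_states A (\<lambda>l. F' l (cell_state A h l)))) (at u)"
proof (rule has_derivative_vecI)
  fix p :: "3 \<times> 'n"
  have "((\<lambda>u. cell_state A u l) has_derivative (\<lambda>h. cell_state A h l)) (at u)" for l
    by (rule linear_imp_has_derivative[OF linear_cell_state])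
  then have "((\<lambda>u. F (cell_state A u l)) has_derivative (\<lambda>h. F' l (cell_state A h l))) (at u)" for l
    by (rule has_derivative_compose) (rule assms)
  then have "((\<lambda>u. F (cell_state A u l) $ c) has_derivative (\<lambda>h. F' l (cell_state A h l) $ c)) (at u)"
    for l c
    by (rule bounded_linear.has_derivative[OF bounded_linear_vec_nth])
  then show "((\<lambda>u. from_cell_states A (\<lambda>l. F (cell_state A u l)) $ p) has_derivative
      (\<lambda>h. from_cell_states A (\<lambda>l. F' l (cell_state A h l)) $ p)) (at u)"
    unfolding from_cell_states_def stack_def from_cells_def
    by (simp add: divide_inverse) (intro derivative_intros)
qed

lemma open_nonzero_density: "open {u. \<forall>l. cell_values A (block 1 u) l \<noteq> 0}"
proof -
  have "continuous_on UNIV (\<lambda>u. cell_state A u l $ 1)" for l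
    by (intro continuous_on_component linear_continuous_on)
       (simp add: linear_conv_bounded_linear[symmetric] linear_cell_state)
  then have "open {u. cell_state A u l $ 1 \<noteq> 0}" for l
    by (intro open_Collect_neq) auto
  then have "open (\<Inter>l. {u. cell_state A u l $ 1 \<noteq> 0})" by auto
  also have "(\<Inter>l. {u. cell_state A u l $ 1 \<noteq> 0}) = {u. \<forall>l. cell_values A (block 1 u) l \<noteq> 0}"
    by (auto simp: cell_state_def)
  finally show ?thesis .
qed

section \<open>Jacobians of the Euler fluxes\<close>

definition euler_jac1 :: "real \<Rightarrow> real^3 \<Rightarrow> real^3^3" where
  "euler_jac1 \<gamma> y = vector
     [vector [0, 1, 0],
      vector [\<gamma> * y$1 powr (\<gamma> - 1) - (y$2 / y$1)\<^sup>2, 2 * (y$2 / y$1), 0],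
      vector [- (y$2 / y$1) * (y$3 / y$1), y$3 / y$1, y$2 / y$1]]"

definition euler_jac2 :: "real \<Rightarrow> real^3 \<Rightarrow> real^3^3" where
  "euler_jac2 \<gamma> y = vector
     [vector [0, 0, 1],
      vector [- (y$2 / y$1) * (y$3 / y$1), y$3 / y$1, y$2 / y$1],
      vector [\<gamma> * y$1 powr (\<gamma> - 1) - (y$3 / y$1)\<^sup>2, 0, 2 * (y$3 / y$1)]]"

text \<open>One formula for all momentum terms; the squares are the case of equal indices.\<close>

lemma has_derivative_momentum_flux:
  fixes y :: "real^3"
  assumes "0 < y $ 1"
  shows "((\<lambda>y. y $ i * y $ j / y $ 1) has_derivative
    (\<lambda>h. (y $ j / y $ 1) * h $ i + (y $ i / y $ 1) * h $ j - (y $ i / y $ 1) * (y $ j / y $ 1) * h $ 1)) (at y)"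
    using assms
  by (auto intro!: derivative_eq_intros
      bounded_linear.has_derivative[OF bounded_linear_vec_nth has_derivative_ident] simp: field_simps)

lemma has_derivative_pressure:
  fixes y :: "real^3"
  assumes "0 < y $ 1"
  shows "((\<lambda>y. y $ 1 powr \<gamma>) has_derivative (\<lambda>h. \<gamma> * y $ 1 powr (\<gamma> - 1) * h $ 1)) (at y)"
    using assms
  by (auto intro!: derivative_eq_intros
      bounded_linear.has_derivative[OF bounded_linear_vec_nth has_derivative_ident] simp: powr_diff)

text \<open>In the Jacobians the quotients are the velocities and
  \<open>\<gamma> * y$1 powr (\<gamma> - 1)\<close> is the derivative of the pressure. Each row
  collects the derivative of one flux component.\<close>

lemma has_derivative_euler_flux:
  fixes y :: "real^3"
  assumes "0 < y $ 1"
  shows "(euler_flux1 \<gamma> has_derivative (\<lambda>h. euler_jac1 \<gamma> y *v h)) (at y)"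
    and "(euler_flux2 \<gamma> has_derivative (\<lambda>h. euler_jac2 \<gamma> y *v h)) (at y)"
proof -
  note flux = has_derivative_momentum_flux[OF assms]
  note total = has_derivative_add[OF flux has_derivative_pressure[OF assms, of \<gamma>]]
  have comp: "((\<lambda>y. y $ i) has_derivative (\<lambda>h. h $ i)) (at y)" for i
    by (rule bounded_linear.has_derivative[OF bounded_linear_vec_nth has_derivative_ident])
  show "(euler_flux1 \<gamma> has_derivative (\<lambda>h. euler_jac1 \<gamma> y *v h)) (at y)"
  proof (rule has_derivative_vecI)
    fix c :: 3
    note defs = euler_flux1_def euler_jac1_def matrix_vector_mult_def sum_3 power2_eq_square
    consider "c = 1" | "c = 2" | "c = 3" using exhaust_3[of c] by blast
    then show "((\<lambda>y. euler_flux1 \<gamma> y $ c) has_derivative (\<lambda>h. (euler_jac1 \<gamma> y *v h) $ c)) (at y)"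
    proof cases
      case 1
      then show ?thesis
        using has_derivative_eq_rhs[OF comp[of 2]] by (simp add: defs fun_eq_iff algebra_simps)
    next
      case 2
      then show ?thesis
        using has_derivative_eq_rhs[OF total[of 2 2]] by (simp add: defs fun_eq_iff algebra_simps)
    next
      case 3
      then show ?thesis
        using has_derivative_eq_rhs[OF flux[of 2 3]] by (simp add: defs fun_eq_iff algebra_simps)
    qed
  qed
  show "(euler_flux2 \<gamma> has_derivative (\<lambda>h. euler_jac2 \<gamma> y *v h)) (at y)"
  proof (rule has_derivative_vecI)
    fix c :: 3
    note defs = euler_flux2_def euler_jac2_def matrix_vector_mult_def sum_3 power2_eq_square
    consider "c = 1" | "c = 2" | "c = 3" using exhaust_3[of c] by blast
    then show "((\<lambda>y. euler_flux2 \<gamma> y $ c) has_derivative (\<lambda>h. (euler_jac2 \<gamma> y *v h) $ c)) (at y)"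
    proof cases
      case 1
      then show ?thesis
        using has_derivative_eq_rhs[OF comp[of 3]] by (simp add: defs fun_eq_iff algebra_simps)
    next
      case 2
      then show ?thesis
        using has_derivative_eq_rhs[OF flux[of 2 3]] by (simp add: defs fun_eq_iff algebra_simps)
    next
      case 3
      then show ?thesis
        using has_derivative_eq_rhs[OF total[of 3 3]] by (simp add: defs fun_eq_iff algebra_simps)
    qed
  qed
qed

section \<open>Eigenvectors of the Euler Jacobian in a unit direction\<close>

definition euler_speeds :: "real \<Rightarrow> real \<Rightarrow> real^3" where
  "euler_speeds v c = vector [v + c, v - c, v]"

text \<open>The columns are right eigenvectors in the order of \<open>euler_speeds\<close>: two
  acoustic waves along the direction, then the shear wave along its perpendicular.\<close>

definition euler_right :: "real \<Rightarrow> real \<Rightarrow> real \<Rightarrow> real \<Rightarrow> real \<Rightarrow> real^3^3" where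
  "euler_right n1 n2 v1 v2 c = vector
     [vector [1, 1, 0],
      vector [v1 + c * n1, v1 - c * n1, - n2],
      vector [v2 + c * n2, v2 - c * n2, n1]]"

text \<open>The rows are the dual left eigenvectors, that is, the inverse of
  \<open>euler_right\<close> for a unit direction and nonzero \<open>c\<close>.\<close>

definition euler_left :: "real \<Rightarrow> real \<Rightarrow> real \<Rightarrow> real \<Rightarrow> real \<Rightarrow> real^3^3" where
  "euler_left n1 n2 v1 v2 c = vector
     [vector [(1 - (n1 * v1 + n2 * v2) / c) / 2, n1 / (2 * c), n2 / (2 * c)],
      vector [(1 + (n1 * v1 + n2 * v2) / c) / 2, - n1 / (2 * c), - n2 / (2 * c)],
      vector [n2 * v1 - n1 * v2, - n2, n1]]"

lemma euler_right_left:
  assumes "n1\<^sup>2 + n2\<^sup>2 = 1" "c \<noteq> 0"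
  shows "euler_right n1 n2 v1 v2 c ** euler_left n1 n2 v1 v2 c = mat 1"
proof -
  have n: "n1 * n1 = 1 - n2 * n2" using assms(1) by (simp add: power2_eq_square)
  \<comment> \<open>The opposite product is computed: its entries are pairings of left with right
    eigenvectors. For square matrices one order implies the other.\<close>
  have "euler_left n1 n2 v1 v2 c ** euler_right n1 n2 v1 v2 c = mat 1"
    unfolding vec_eq_iff forall_3 matrix_matrix_mult_def euler_right_def euler_left_def mat_def
    using assms(2) by (simp add: sum_3 field_simps) (intro conjI; (use n in algebra | simp add: algebra_simps))
  then show ?thesis
    by (simp add: matrix_left_right_inverse)
qed

text \<open>Here \<open>c\<close> is a speed of sound. Written in the velocities and
  \<open>c\<close>, all entries are polynomials, and they agree modulo the unit length of the
  direction.\<close>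

lemma euler_jac_right:
  fixes y :: "real^3"
  assumes "n1\<^sup>2 + n2\<^sup>2 = 1" "c\<^sup>2 = \<gamma> * y$1 powr (\<gamma> - 1)"
  defines "v1 \<equiv> y$2 / y$1" and "v2 \<equiv> y$3 / y$1"
  shows "(n1 *\<^sub>R euler_jac1 \<gamma> y + n2 *\<^sub>R euler_jac2 \<gamma> y) ** euler_right n1 n2 v1 v2 c =
    euler_right n1 n2 v1 v2 c ** diag_mat (($) (euler_speeds (n1 * v1 + n2 * v2) c))"
proof -
  have n: "n1 * n1 = 1 - n2 * n2" using assms(1) by (simp add: power2_eq_square)
  show ?thesis
    unfolding vec_eq_iff forall_3 matrix_matrix_mult_def euler_right_def euler_jac1_def euler_jac2_def
      diag_mat_def euler_speeds_def assms(2)[symmetric] v1_def[symmetric] v2_def[symmetric]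
    by (simp add: sum_3 power2_eq_square) (intro conjI; (use n in algebra | simp add: algebra_simps))
qed

section \<open>Spectrum of the Galerkin fluxes\<close>

lemma jacobian_eqI:
  fixes f :: "real^'m \<Rightarrow> real^'k"
  assumes "(f has_derivative f') (at x)"
  shows "jacobian f (at x) *v h = f' h"
proof -
  have "f' = frechet_derivative f (at x)" "linear f'"
    using frechet_derivative_at[OF assms] has_derivative_linear[OF assms] by auto
  then show ?thesis by (simp add: jacobian_def)
qed

lemma from_cell_states_combination:
  "from_cell_states A (\<lambda>l. r *\<^sub>R a l + s *\<^sub>R b l) =
    r *\<^sub>R from_cell_states A a + s *\<^sub>R from_cell_states A b"
  by (simp add: from_cell_states_def from_cells_def stack_def vec_eq_iff sum.distrib
      sum_distrib_left algebra_simps add_divide_distrib)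

text \<open>In cell values \<open>J\<close> is block diagonal with blocks \<open>M l\<close>. The
  eigenbases of the blocks together diagonalise \<open>J\<close>, and the diagonal is indexed by
  pairs (wave, cell).\<close>

lemma cellwise_diagonalisation:
  fixes A :: "'n::{finite,linorder} sqmat" and M R L :: "'n \<Rightarrow> real^3^3"
  assumes "haar_type A"
    and J: "\<And>h. J *v h = from_cell_states A (\<lambda>l. M l *v cell_state A h l)"
    and M: "\<And>l. M l ** R l = R l ** diag_mat (d l)" and RL: "\<And>l. R l ** L l = mat 1"
  shows "\<exists>P Q. P ** Q = mat 1 \<and> J = P ** diag_mat (\<lambda>(c, l). d l c) ** Q"
proof -
  \<comment> \<open>\<open>p\<close> maps wave amplitudes on the cells to a state and
    \<open>q\<close> goes back. In the argument of \<open>p\<close> the second index is a cell, no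
    longer a mode.\<close>
  define p :: "'n state \<Rightarrow> 'n state" where
    "p = (\<lambda>y. from_cell_states A (\<lambda>l. R l *v (\<chi> c. y $ (c, l))))"
  define q :: "'n state \<Rightarrow> 'n state" where
    "q = (\<lambda>h. \<chi> p. (L (snd p) *v cell_state A h (snd p)) $ fst p)"
  have "linear (\<lambda>y::'n state. \<chi> c. y $ (c, l))" for l
    by (rule linearI) (simp_all add: vec_eq_iff)
  then have "linear (\<lambda>y::'n state. R l *v (\<chi> c. y $ (c, l)))" for l
    using linear_compose[OF _ matrix_vector_mul_linear] by (auto simp: o_def)
  then have p: "linear p"
    unfolding p_def by (rule linear_from_cell_states)
  have q: "linear q"
    unfolding q_def
    by (rule linearI)
       (simp_all add: vec_eq_iff linear_add[OF linear_cell_state] linear_scale[OF linear_cell_state]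
         matrix_vector_right_distrib matrix_vector_mult_scaleR)
  have q_cell: "(\<chi> c. q h $ (c, l)) = L l *v cell_state A h l" for h l
    by (simp add: q_def vec_eq_iff)
  have pq: "p (q h) = h" for h
    unfolding p_def q_cell matrix_vector_mul_assoc RL using assms(1) by simp
  have "matrix p ** matrix q = mat 1"
    unfolding matrix_eq matrix_vector_mul_assoc[symmetric] using p q pq by simp
  moreover have "J = matrix p ** diag_mat (\<lambda>(c, l). d l c) ** matrix q"
  proof -
    have "J *v h = p (diag_mat (\<lambda>(c, l). d l c) *v q h)" for h
    proof -
      have 1: "diag_mat e *v x = (\<chi> i. e i * x $ i)" for e and x :: "real^'k"
        by (simp add: vec_eq_iff matrix_vector_mult_def diag_mat_def
            if_distrib[where f="\<lambda>x. x * _"] cong: if_cong)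
      have 2: "(\<chi> c. (diag_mat (\<lambda>(c, l). d l c) *v q h) $ (c, l)) = diag_mat (d l) *v (L l *v cell_state A h l)" for l
        unfolding q_cell[symmetric] 1 by (simp add: vec_eq_iff)
      have "R l ** diag_mat (d l) ** L l = M l" for l
        unfolding M[symmetric] matrix_mul_assoc[symmetric] RL by simp
      then show ?thesis
        unfolding p_def 2 matrix_vector_mul_assoc J by (simp add: matrix_mul_assoc)
    qed
    then show ?thesis
      unfolding matrix_eq matrix_vector_mul_assoc[symmetric] using p q by simp
  qed
  ultimately show ?thesis by blast
qed

text \<open>The Galerkin flux equals the cellwise Euler flux on an open set around \<open>u\<close>,
  so both have the same derivative there.\<close>

lemma f_hat_has_derivative:
  fixes A :: "'n::{finite,linorder} sqmat"
  assumes "haar_type A" "\<And>l. 0 < cell_values A (block 1 u) l"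
  shows "(f_hat1 A \<gamma> has_derivative
      (\<lambda>h. from_cell_states A (\<lambda>l. euler_jac1 \<gamma> (cell_state A u l) *v cell_state A h l))) (at u)"
    and "(f_hat2 A \<gamma> has_derivative
      (\<lambda>h. from_cell_states A (\<lambda>l. euler_jac2 \<gamma> (cell_state A u l) *v cell_state A h l))) (at u)"
proof -
  let ?S = "{u. \<forall>l. cell_values A (block 1 u) l \<noteq> 0}"
  have u: "u \<in> ?S" using assms(2) by (auto simp: less_le)
  have pos: "0 < cell_state A u l $ 1" for l using assms(2) by (simp add: cell_state_def)
  show "(f_hat1 A \<gamma> has_derivative
      (\<lambda>h. from_cell_states A (\<lambda>l. euler_jac1 \<gamma> (cell_state A u l) *v cell_state A h l))) (at u)"
    by (rule has_derivative_transform_within_open[OF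
          has_derivative_cellwise[OF has_derivative_euler_flux(1)[OF pos]] open_nonzero_density u])
       (simp add: f_hat_eq assms(1))
  show "(f_hat2 A \<gamma> has_derivative
      (\<lambda>h. from_cell_states A (\<lambda>l. euler_jac2 \<gamma> (cell_state A u l) *v cell_state A h l))) (at u)"
    by (rule has_derivative_transform_within_open[OF
          has_derivative_cellwise[OF has_derivative_euler_flux(2)[OF pos]] open_nonzero_density u])
       (simp add: f_hat_eq assms(1))
qed

text \<open>The diagonals of \<open>N\<close> and \<open>C\<close> hold the normal velocity
  \<open>v\<close> and the speed of sound \<open>c\<close> of each cell, which are the data of the
  Euler eigenvalues on that cell.\<close>

lemma f_hat_spectrum:
  fixes A :: "'n::{finite,linorder} sqmat" and u :: "'n state"
  assumes A: "haar_type A" and \<gamma>: "\<gamma> > 0" and pos: "\<And>l. 0 < cell_values A (block 1 u) l"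
    and n: "n1\<^sup>2 + n2\<^sup>2 = 1"
  defines "J \<equiv> n1 *\<^sub>R jacobian (f_hat1 A \<gamma>) (at u) + n2 *\<^sub>R jacobian (f_hat2 A \<gamma>) (at u)"
    and "N \<equiv> n1 *\<^sub>R D_nu1 A u + n2 *\<^sub>R D_nu2 A u"
    and "C \<equiv> sqrt \<gamma> *\<^sub>R diag_powr (eig_mat A (block 1 u)) ((\<gamma> - 1) / 2)"
  shows "char_fun J z = (\<Prod>k\<in>UNIV. (z - complex_of_real ((N + C) $ k $ k)) *
      (z - complex_of_real ((N - C) $ k $ k)) * (z - complex_of_real (N $ k $ k)))"
proof -
  let ?y = "cell_state A u"
  define v c where "v = (\<lambda>l. n1 * (?y l $ 2 / ?y l $ 1) + n2 * (?y l $ 3 / ?y l $ 1))"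
    and "c = (\<lambda>l. sqrt \<gamma> * (?y l $ 1) powr ((\<gamma> - 1) / 2))"
  have y: "0 < ?y l $ 1" for l using pos by (simp add: cell_state_def)
  \<comment> \<open>Squaring undoes the halved exponent and gives the derivative of the pressure.
    Positivity of \<gamma> and of the density keeps \<open>c\<close> away from 0, as the inverse of
    the eigenvector matrix requires.\<close>
  have c: "(c l)\<^sup>2 = \<gamma> * (?y l $ 1) powr (\<gamma> - 1)" "c l \<noteq> 0" for l
    using \<gamma> y[of l] by (simp_all add: c_def power_mult_distrib powr_power diff_divide_distrib)
  have "N = diag_mat v"
    using pos
    by (simp add: N_def D_nu_eq[OF A] less_imp_neq[THEN not_sym] v_def cell_state_def diag_mat_def vec_eq_iff)
  moreover have "C = diag_mat c"
    unfolding C_def eig_mat_cell_values[OF A] diag_powr_diag_mat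
    by (simp add: c_def cell_state_def diag_mat_def vec_eq_iff)
  ultimately have NC: "N $ k $ k = v k" "(N + C) $ k $ k = v k + c k" "(N - C) $ k $ k = v k - c k" for k
    by (simp_all add: diag_mat_def)
  have J: "J *v h = from_cell_states A
      (\<lambda>l. (n1 *\<^sub>R euler_jac1 \<gamma> (?y l) + n2 *\<^sub>R euler_jac2 \<gamma> (?y l)) *v cell_state A h l)" for h
    using f_hat_has_derivative[OF A pos, THEN jacobian_eqI]
    by (simp add: J_def matrix_vector_mult_add_rdistrib from_cell_states_combination
        flip: scaleR_matrix_vector_assoc)
  obtain P Q where "P ** Q = mat 1"
    and "J = P ** diag_mat (\<lambda>(i, l). euler_speeds (v l) (c l) $ i) ** Q"
    using cellwise_diagonalisation[OF A J euler_jac_right[OF n c(1)] euler_right_left[OF n c(2)]]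
    unfolding v_def by blast
  then have "char_fun J z = (\<Prod>(i, l)\<in>UNIV. z - complex_of_real (euler_speeds (v l) (c l) $ i))"
    by (simp add: char_fun_diagonalised case_prod_unfold)
  \<comment> \<open>The product over pairs is split so that the three waves become three products
    over cells, which recombine into one product of three factors per cell.\<close>
  also have "\<dots> = (\<Prod>i\<in>UNIV. \<Prod>l\<in>UNIV. z - complex_of_real (euler_speeds (v l) (c l) $ i))"
    using prod.cartesian_product[of "\<lambda>i l. z - complex_of_real (euler_speeds (v l) (c l) $ i)" UNIV UNIV]
    unfolding UNIV_Times_UNIV by (rule sym)
  finally show ?thesis
    unfolding NC UNIV_3 by (simp add: euler_speeds_def prod.distrib mult.assoc)
qed

text \<open>The characteristic function accompanies the eigenvalue set because it also records
  multiplicities. Square integrability and differentiability are asserted because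
  \<open>modes\<close> and \<open>jacobian\<close> are total and take default values
  otherwise.\<close>

theorem corollary4:
  fixes A :: "'n::{finite,linorder} sqmat" and \<gamma> :: real
  assumes haar: "haar_type A" and gamma: "\<gamma> > 0"
  shows
    "(\<forall>u::'n state. block 1 u \<in> pos_states A \<longrightarrow>
       invertible (eig_mat A (block 1 u)) \<and>
       square_integrable (\<lambda>\<xi>. expansion A (block 1 u) \<xi> powr \<gamma>) \<and>
       modes A (\<lambda>\<xi>. expansion A (block 1 u) \<xi> powr \<gamma>) = p_hat A \<gamma> (block 1 u) \<and>
       (\<forall>c. square_integrable (\<lambda>\<xi>. euler_flux1 \<gamma> (random_state A u \<xi>) $ c) \<and>
            square_integrable (\<lambda>\<xi>. euler_flux2 \<gamma> (random_state A u \<xi>) $ c) \<and>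
            block c (f_hat1 A \<gamma> u) = modes A (\<lambda>\<xi>. euler_flux1 \<gamma> (random_state A u \<xi>) $ c) \<and>
            block c (f_hat2 A \<gamma> u) = modes A (\<lambda>\<xi>. euler_flux2 \<gamma> (random_state A u \<xi>) $ c)) \<and>
       f_hat1 A \<gamma> differentiable (at u) \<and>
       f_hat2 A \<gamma> differentiable (at u) \<and>
       (\<forall>n1 n2 :: real. n1\<^sup>2 + n2\<^sup>2 = 1 \<longrightarrow>
         (let J = n1 *\<^sub>R jacobian (f_hat1 A \<gamma>) (at u) + n2 *\<^sub>R jacobian (f_hat2 A \<gamma>) (at u);
              N = n1 *\<^sub>R D_nu1 A u + n2 *\<^sub>R D_nu2 A u;
              C = sqrt \<gamma> *\<^sub>R diag_powr (eig_mat A (block 1 u)) ((\<gamma> - 1) / 2)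
          in eigenvalues J =
               (\<Union>k. {complex_of_real ((N + C) $ k $ k),
                     complex_of_real ((N - C) $ k $ k),
                     complex_of_real (N $ k $ k)}) \<and>
             (\<forall>z. char_fun J z =
               (\<Prod>k\<in>UNIV. (z - complex_of_real ((N + C) $ k $ k)) *
                           (z - complex_of_real ((N - C) $ k $ k)) *
                           (z - complex_of_real (N $ k $ k))))))) \<and>
     (\<forall>\<Omega> (U :: real \<times> real \<times> real \<Rightarrow> 'n state).
       open \<Omega> \<longrightarrow> (\<forall>z\<in>\<Omega>. block 1 (U z) \<in> pos_states A) \<longrightarrow>
       (conservation_law (projected_flux A (euler_flux1 \<gamma>)) (projected_flux A (euler_flux2 \<gamma>)) \<Omega> U
          \<longleftrightarrow> conservation_law (f_hat1 A \<gamma>) (f_hat2 A \<gamma>) \<Omega> U))"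
proof (intro conjI allI impI)
  fix u :: "'n state"
  assume "block 1 u \<in> pos_states A"
  then have pos: "0 < cell_values A (block 1 u) l" for l
    by (rule pos_states_cell_values[OF haar])
  then have nz: "cell_values A (block 1 u) l \<noteq> 0" for l
    by (simp add: less_imp_neq[THEN not_sym])
  show "invertible (eig_mat A (block 1 u))"
    by (simp add: eig_mat_cell_values[OF haar] diag_mat_inverse nz)
  have "(\<lambda>\<xi>. expansion A (block 1 u) \<xi> powr \<gamma>) \<in> borel_measurable borel" by measurable
  note pressure = square_integrable_and_modes[OF this, where d = "\<lambda>l. cell_values A (block 1 u) l powr \<gamma>"]
  show "square_integrable (\<lambda>\<xi>. expansion A (block 1 u) \<xi> powr \<gamma>)"
    by (rule pressure(1)) (simp add: expansion_on_cell)
  show "modes A (\<lambda>\<xi>. expansion A (block 1 u) \<xi> powr \<gamma>) = p_hat A \<gamma> (block 1 u)"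
    unfolding p_hat_eq[OF haar] by (rule pressure(2)) (simp add: expansion_on_cell)
  fix c
  note flux =
    square_integrable_and_modes(1)[OF euler_flux_random_state_measurable(1),
      where d = "\<lambda>l. euler_flux1 \<gamma> (cell_state A u l) $ c"]
    square_integrable_and_modes(1)[OF euler_flux_random_state_measurable(2),
      where d = "\<lambda>l. euler_flux2 \<gamma> (cell_state A u l) $ c"]
  show "square_integrable (\<lambda>\<xi>. euler_flux1 \<gamma> (random_state A u \<xi>) $ c)"
    by (rule flux(1)) (simp add: random_state_on_cell)
  show "square_integrable (\<lambda>\<xi>. euler_flux2 \<gamma> (random_state A u \<xi>) $ c)"
    by (rule flux(2)) (simp add: random_state_on_cell)
  \<comment> \<open>Both sides are the Euler flux evaluated cell by cell.\<close>
  have projected: "f_hat1 A \<gamma> u = projected_flux A (euler_flux1 \<gamma>) u"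
    "f_hat2 A \<gamma> u = projected_flux A (euler_flux2 \<gamma>) u"
    by (simp_all add: f_hat_eq[OF haar nz] projected_euler_flux)
  show "block c (f_hat1 A \<gamma> u) = modes A (\<lambda>\<xi>. euler_flux1 \<gamma> (random_state A u \<xi>) $ c)"
    "block c (f_hat2 A \<gamma> u) = modes A (\<lambda>\<xi>. euler_flux2 \<gamma> (random_state A u \<xi>) $ c)"
    unfolding projected by (simp_all add: projected_flux_def)
next
  fix u :: "'n state"
  assume "block 1 u \<in> pos_states A"
  then have pos: "0 < cell_values A (block 1 u) l" for l
    by (rule pos_states_cell_values[OF haar])
  show "f_hat1 A \<gamma> differentiable (at u)" "f_hat2 A \<gamma> differentiable (at u)"
    using f_hat_has_derivative[OF haar pos] by (blast intro: differentiableI)+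
  fix n1 n2 :: real
  assume "n1\<^sup>2 + n2\<^sup>2 = 1"
  note char = f_hat_spectrum[OF haar gamma pos this]
  then show "let J = n1 *\<^sub>R jacobian (f_hat1 A \<gamma>) (at u) + n2 *\<^sub>R jacobian (f_hat2 A \<gamma>) (at u);
              N = n1 *\<^sub>R D_nu1 A u + n2 *\<^sub>R D_nu2 A u;
              C = sqrt \<gamma> *\<^sub>R diag_powr (eig_mat A (block 1 u)) ((\<gamma> - 1) / 2)
          in eigenvalues J =
               (\<Union>k. {complex_of_real ((N + C) $ k $ k),
                     complex_of_real ((N - C) $ k $ k),
                     complex_of_real (N $ k $ k)}) \<and>
             (\<forall>z. char_fun J z =
               (\<Prod>k\<in>UNIV. (z - complex_of_real ((N + C) $ k $ k)) *
                           (z - complex_of_real ((N - C) $ k $ k)) *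
                           (z - complex_of_real (N $ k $ k))))"
    \<comment> \<open>A finite product vanishes iff a factor does, so the eigenvalue set is read off
      from the characteristic function.\<close>
    unfolding Let_def eigenvalues_char_fun char by (auto simp: prod_zero_iff)
next
  fix \<Omega> and U :: "real \<times> real \<times> real \<Rightarrow> 'n state"
  assume "open \<Omega>" "\<forall>z\<in>\<Omega>. block 1 (U z) \<in> pos_states A"
  then show "conservation_law (projected_flux A (euler_flux1 \<gamma>)) (projected_flux A (euler_flux2 \<gamma>)) \<Omega> U
      \<longleftrightarrow> conservation_law (f_hat1 A \<gamma>) (f_hat2 A \<gamma>) \<Omega> U"
    using pos_states_cell_values[OF haar]
    by (intro conservation_law_cong)
       (simp_all add: projected_euler_flux f_hat_eq[OF haar] less_imp_neq[THEN not_sym])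
qed

end
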